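(* Let $f$ be a holomorphic function on $\{\zeta\in\mathbb{C}: |\zeta|>1\}$ such that $f(\{|\zeta|>1\})\subset\mathbb{C}\setminus\{0\}$, and let $n$ be a non-negative integer. Suppose that every real-analytic curve $\gamma:[0,1)\to\{|\zeta|>1\}$ tending to $\infty$ (i.e. $|\gamma(t)|\to\infty$ as $t\to 1$) satisfies $$\int_\gamma|\log\zeta|^n\,|f(\zeta)|\,|d\zeta|=\infty.$$ Then $f$ is meromorphic at $\infty$.
   Context: In the integral, $\log\zeta$ is the possibly multivalued logarithm, taken along $\gamma$ as a continuous branch: if $L:[0,1)\to\mathbb{C}$ is continuous with $e^{L(t)}=\gamma(t)$, then $\int_\gamma|\log\zeta|^n|f(\zeta)||d\zeta|=\int_0^1|L(t)|^n|f(\gamma(t))||\gamma'(t)|\,dt$. So the imaginary part of $\log\zeta$ records the total variation of the argument along $\gamma$ and is not reduced modulo $2\pi$. Since $|\gamma(t)|\to\infty$, whether this integral is infinite does not depend on which continuous branch $L$ is chosen. For $n=0$ the factor $|\log\zeta|^n$ is $1$. "Meromorphic at $\infty$" means that the isolated singularity of $f$ at $\infty$ is either removable or a pole (not essential). *)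

theory Defs
  imports "HOL-Complex_Analysis.Complex_Analysis"
begin

text \<open>At an endpoint of \<open>S\<close> lying in \<open>S\<close> the expansion is only required on the
  side belonging to \<open>S\<close>; its two-sided convergence is then automatic.\<close>

definition real_analytic_curve_on :: "(real \<Rightarrow> complex) \<Rightarrow> real set \<Rightarrow> bool" where
  "real_analytic_curve_on \<gamma> S \<longleftrightarrow>
     (\<forall>t0\<in>S. \<exists>r>0. \<exists>a :: nat \<Rightarrow> complex. \<forall>t\<in>S. \<bar>t - t0\<bar> < r \<longrightarrow>
        (\<lambda>k. a k * of_real (t - t0) ^ k) sums \<gamma> t)"

definition log_branch_along :: "(real \<Rightarrow> complex) \<Rightarrow> (real \<Rightarrow> complex) \<Rightarrow> bool" where
  "log_branch_along L \<gamma> \<longleftrightarrow>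
     continuous_on {0..<1} L \<and> (\<forall>t\<in>{0..<1}. exp (L t) = \<gamma> t)"

text \<open>The derivative is taken within the parameter interval, so that the values of \<open>\<gamma>\<close>
  outside \<open>[0,1)\<close> are irrelevant.\<close>

definition log_weighted_integral ::
  "nat \<Rightarrow> (complex \<Rightarrow> complex) \<Rightarrow> (real \<Rightarrow> complex) \<Rightarrow> (real \<Rightarrow> complex) \<Rightarrow> ennreal" where
  "log_weighted_integral n f \<gamma> L =
     (\<integral>\<^sup>+ t\<in>{0..<1}. ennreal (norm (L t) ^ n * norm (f (\<gamma> t)) *
        norm (vector_derivative \<gamma> (at t within {0..<1}))) \<partial>lborel)"

definition meromorphic_at_infinity :: "(complex \<Rightarrow> complex) \<Rightarrow> bool" where
  "meromorphic_at_infinity f \<longleftrightarrow>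
     isolated_singularity_at (\<lambda>w. f (inverse w)) 0 \<and> not_essential (\<lambda>w. f (inverse w)) 0"

end

theory Submission
  imports Defs
begin

text \<open>
  Up to a factor of polynomial growth, a holomorphic function without zeros on
  \<open>{|z| > 1}\<close> is the exponential of an entire function \<open>G\<close>: the Laurent splitting of
  \<open>f'/f\<close> has an entire part, which has a primitive \<open>G\<close>, and a remainder of order
  \<open>1/|z|\<close>, which contributes at most a power \<open>|z|\<^sup>M\<close>
  (\<open>exterior_factorization\<close>). Hence for large \<open>z\<close> the function \<open>|f|\<close> is dominated by
  the modulus of \<open>F' = z\<^sup>M exp G\<close>, where \<open>F\<close> is entire, \<open>F 0 = 0\<close>, and \<open>F'\<close> vanishes
  at most at the origin.

  Near the origin \<open>F\<close> is the \<open>m\<close>-th power of a local coordinate, so there is a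
  holomorphic \<open>\<psi>\<close> with \<open>\<psi> 0 = 0\<close> and \<open>F (\<psi> w) = w\<^sup>m\<close>. It is injective on its whole
  disc of convergence (\<open>power_inverse_inj_on\<close>). Since \<open>F\<close> is locally invertible away
  from the origin, the only obstruction to enlarging that disc is a boundary point \<open>\<xi>\<close>
  for which \<open>\<psi> (s \<xi>)\<close> tends to infinity as \<open>s\<close> increases to 1
  (\<open>power_inverse_maximal_disc\<close>).

  If the disc has finite radius \<open>R\<close>, the image of such a radius is the curve that
  contradicts the hypothesis. The form \<open>|F' (\<psi> w)| |\<psi>' w| = m |w|\<^sup>m\<^sup>-\<^sup>1\<close> is bounded on
  it, so its unweighted length is finite. The weight \<open>|log \<zeta>|\<^sup>n\<close> is harmless
  because \<open>\<psi>\<close> is univalent and has no zero other than the origin: a branch of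
  \<open>log \<psi>\<close> never takes two values that differ by \<open>2 \<pi> \<i>\<close>, so by Bloch's theorem its
  derivative is at most a constant divided by the distance to the circle
  (\<open>log_derivative_univalent_bound\<close>). Thus \<open>log \<psi>\<close>, its imaginary part included, grows
  along the radius at most like \<open>log (1/(1-s))\<close>, and every power of that is integrable.

  If the radius is infinite, the same bound and Liouville's theorem make \<open>\<psi>\<close> linear
  (\<open>entire_injective_imp_linear\<close>). Then \<open>F\<close> is a monomial, \<open>f\<close> has polynomial growth,
  and the singularity at infinity is not essential.
\<close>

section \<open>Functions without zeros on an exterior domain\<close>

lemma holomorphic_Cauchy_transform_circle:
  assumes "continuous_on (sphere 0 r) g" "r > 0"
  shows "(\<lambda>z. contour_integral (circlepath 0 r) (\<lambda>u. g u / (u - z))) holomorphic_on - sphere 0 r"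
proof -
  have pi: "path_image (circlepath 0 r) = sphere 0 r" using assms(2) by simp
  have int: "((\<lambda>u. g u / (u - z) ^ 1) has_contour_integral
              contour_integral (circlepath 0 r) (\<lambda>u. g u / (u - z))) (circlepath 0 r)"
    if "z \<in> UNIV - path_image (circlepath 0 r)" for z
  proof -
    have "continuous_on (sphere 0 r) (\<lambda>u. g u / (u - z))"
      using that pi by (intro continuous_intros assms) auto
    then have "(\<lambda>u. g u / (u - z)) contour_integrable_on (circlepath 0 r)"
      by (intro contour_integrable_continuous_circlepath) (simp only: pi)
    then show ?thesis by (simp add: has_contour_integral_integral)
  qed
  have "\<exists>d. ((\<lambda>z. contour_integral (circlepath 0 r) (\<lambda>u. g u / (u - z))) has_field_derivative d) (at z)"
    if "z \<in> - sphere 0 r" for z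
  proof -
    have "norm (vector_derivative (circlepath 0 r) (at t)) \<le> 2 * pi * \<bar>r\<bar>" for t
      by (simp add: vector_derivative_circlepath norm_mult)
    from Cauchy_next_derivative(2)[of "circlepath 0 r" g, OF _ this int _ open_UNIV _, of z]
    show ?thesis unfolding pi using that assms(1) valid_path_circlepath zero_neq_one
      by (metis Compl_eq_Diff_UNIV)
  qed
  then show ?thesis
    by (subst holomorphic_on_open) auto
qed

text \<open>
  The radial homotopy between the two circles stays at modulus at least \<open>r\<close>.
\<close>
lemma contour_integral_circlepath_deform:
  assumes k: "k holomorphic_on {z. R < norm z}" and "0 \<le> R" "R < r" "r \<le> r'"
  shows "contour_integral (circlepath 0 r') k = contour_integral (circlepath 0 r) k"
proof (rule Cauchy_theorem_homotopic_loops[OF _ _ k])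
  show "homotopic_loops {z. R < norm z} (circlepath 0 r') (circlepath 0 r)"
  proof (rule homotopic_loops_linear)
    fix t :: real
    define e where "e = exp (2 * of_real pi * \<i> * of_real t)"
    have e: "norm e = 1" by (simp add: e_def norm_exp_eq_Re)
    show "closed_segment (circlepath 0 r' t) (circlepath 0 r t) \<subseteq> {z. R < norm z}"
    proof
      fix x assume "x \<in> closed_segment (circlepath 0 r' t) (circlepath 0 r t)"
      then obtain u where u: "0 \<le> u" "u \<le> 1" "x = (1 - u) *\<^sub>R (r' * e) + u *\<^sub>R (r * e)"
        by (auto simp: circlepath closed_segment_def e_def)
      have "x = of_real ((1 - u) * r' + u * r) * e"
        using u(3) by (simp add: scaleR_conv_of_real algebra_simps)
      then have "norm x = \<bar>(1 - u) * r' + u * r\<bar>"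
        by (simp only: norm_mult norm_of_real e mult_1_right)
      moreover have "(1 - u) * r' + u * r \<ge> (1 - u) * r + u * r"
        using u assms by (intro add_mono mult_left_mono) auto
      then have "(1 - u) * r' + u * r \<ge> r" by (simp add: algebra_simps)
      ultimately show "x \<in> {z. R < norm z}" using assms by auto
    qed
  qed auto
qed (auto intro!: open_Collect_less continuous_intros)

text \<open>
  The difference quotient of \<open>g\<close> at \<open>z\<close> has a removable singularity, so its integrals over
  the two circles agree; only the outer circle winds around \<open>z\<close>.
\<close>
lemma Cauchy_integral_formula_annulus:
  assumes g: "g holomorphic_on {z. R < norm z}" and R: "0 \<le> R" "R < r" "r < norm z" "norm z < r'"
  shows "contour_integral (circlepath 0 r') (\<lambda>u. g u / (u - z))
         = 2 * of_real pi * \<i> * g z + contour_integral (circlepath 0 r) (\<lambda>u. g u / (u - z))"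
proof -
  define k where "k u = (if u = z then deriv g z else (g u - g z) / (u - z))" for u
  have op: "open {z::complex. R < norm z}"
    by (auto intro!: open_Collect_less continuous_intros)
  have k: "k holomorphic_on {z. R < norm z}"
    unfolding k_def by (rule pole_lemma_open[OF g op])
  have split: "contour_integral (circlepath 0 s) k
        = contour_integral (circlepath 0 s) (\<lambda>u. g u / (u - z))
          - g z * contour_integral (circlepath 0 s) (\<lambda>u. 1 / (u - z))"
    if s: "R < s" "s \<noteq> norm z" for s
  proof -
    have s0: "s > 0" using s R by simp
    have pi: "path_image (circlepath 0 s) = sphere 0 s" using s0 by simp
    have c1: "(\<lambda>u. g u / (u - z)) contour_integrable_on (circlepath 0 s)"
      by (intro contour_integrable_continuous_circlepath continuous_intros)
         (use s s0 in \<open>auto simp: pi intro!: continuous_on_subset[OF holomorphic_on_imp_continuous_on[OF g]]\<close>)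
    have c2: "(\<lambda>u. 1 / (u - z)) contour_integrable_on (circlepath 0 s)"
      by (intro contour_integrable_continuous_circlepath continuous_intros)
         (use s s0 in \<open>auto simp: pi\<close>)
    have "contour_integral (circlepath 0 s) k
        = contour_integral (circlepath 0 s) (\<lambda>u. g u / (u - z) - g z * (1 / (u - z)))"
      by (rule contour_integral_cong) (use s s0 in \<open>auto simp: k_def diff_divide_distrib\<close>)
    also have "\<dots> = contour_integral (circlepath 0 s) (\<lambda>u. g u / (u - z))
          - g z * contour_integral (circlepath 0 s) (\<lambda>u. 1 / (u - z))"
      using c1 c2 by (simp only: contour_integral_diff contour_integrable_lmul contour_integral_lmul)
    finally show ?thesis .
  qed
  have outer: "contour_integral (circlepath 0 r') (\<lambda>u. 1 / (u - z)) = 2 * of_real pi * \<i>"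
    using Cauchy_integral_circlepath_simple[of "\<lambda>_. 1" 0 r' z] R
    by (auto intro!: contour_integral_unique)
  have inner: "contour_integral (circlepath 0 r) (\<lambda>u. 1 / (u - z)) = 0"
    by (rule contour_integral_unique, rule Cauchy_theorem_convex_simple[of _ "ball 0 (norm z)"])
       (use R in \<open>auto intro!: holomorphic_intros\<close>)
  have "contour_integral (circlepath 0 r') k = contour_integral (circlepath 0 r) k"
    by (rule contour_integral_circlepath_deform[OF k]) (use R in auto)
  then show ?thesis
    using split[of r] split[of r'] R outer inner by (simp add: algebra_simps)
qed

text \<open>
  The Cauchy integral over the outer circle and \<open>g\<close> plus the one over the inner circle
  coincide on the annulus between them, so they glue to an entire function. The remainder
  is a Cauchy integral over a fixed circle, and therefore decays like \<open>1/|z|\<close>.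
\<close>
lemma Laurent_split_exterior:
  assumes g: "g holomorphic_on {z. 1 < norm z}"
  obtains g2 C where "g2 holomorphic_on UNIV" "C \<ge> 0"
    "\<And>z. norm z \<ge> 2 \<Longrightarrow> norm (g z - g2 z) \<le> C / norm z"
proof -
  define J where "J r z = contour_integral (circlepath 0 r) (\<lambda>u. g u / (u - z)) / (2 * of_real pi * \<i>)" for r z
  have cont: "continuous_on (sphere 0 r) g" if "r > 1" for r
    by (rule continuous_on_subset[OF holomorphic_on_imp_continuous_on[OF g]]) (use that in auto)
  have J: "J r holomorphic_on - sphere 0 r" if "r > 1" for r
    unfolding J_def using that by (intro holomorphic_intros holomorphic_Cauchy_transform_circle cont) auto
  define g2 where "g2 z = (if z \<in> ball 0 2 then J 2 z else g z + J (3/2) z)" for z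
  have "g2 holomorphic_on (ball 0 2 \<union> - cball 0 (3/2))"
    unfolding g2_def
  proof (rule holomorphic_on_If_Un)
    show "J 2 holomorphic_on ball 0 2"
      by (rule holomorphic_on_subset[OF J]) auto
    show "(\<lambda>z. g z + J (3/2) z) holomorphic_on - cball 0 (3/2)"
      by (intro holomorphic_intros holomorphic_on_subset[OF J] holomorphic_on_subset[OF g]) auto
    fix z :: complex assume "z \<in> ball 0 2" "z \<in> - cball 0 (3/2)"
    then show "J 2 z = g z + J (3/2) z"
      unfolding J_def
      by (subst Cauchy_integral_formula_annulus[OF g, of "3/2" z 2]) (auto simp: field_simps)
  qed auto
  moreover have "ball 0 2 \<union> - cball 0 (3/2) = (UNIV :: complex set)"
    by auto
  ultimately have hol: "g2 holomorphic_on UNIV" by simp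
  obtain B where B: "B \<ge> 0" "\<And>u. u \<in> sphere 0 (3/2) \<Longrightarrow> norm (g u) \<le> B"
    using continuous_on_compact_bound[OF compact_sphere cont[of "3/2"]] by auto
  show ?thesis
  proof (rule that[OF hol, of "6 * B"])
    show "6 * B \<ge> 0" using B by simp
    fix z :: complex assume z: "norm z \<ge> 2"
    have int: "((\<lambda>u. g u / (u - z)) has_contour_integral
          contour_integral (circlepath 0 (3/2)) (\<lambda>u. g u / (u - z))) (circlepath 0 (3/2))"
      by (intro has_contour_integral_integral contour_integrable_continuous_circlepath continuous_intros)
         (use z in \<open>auto intro!: cont\<close>)
    have bound: "norm (contour_integral (circlepath 0 (3/2)) (\<lambda>u. g u / (u - z)))
           \<le> (4 * B / norm z) * (2 * pi * (3/2))"
    proof (rule has_contour_integral_bound_circlepath[OF int])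
      fix u :: complex assume u: "norm (u - 0) = 3/2"
      have "norm (u - z) \<ge> norm z - 3/2"
        using u norm_triangle_ineq2[of z u] by (simp add: norm_minus_commute)
      then have d: "norm (u - z) \<ge> norm z / 4" using z by simp
      have "norm (g u / (u - z)) \<le> B / (norm z / 4)"
        unfolding norm_divide using B u z d by (intro frac_le) auto
      then show "norm (g u / (u - z)) \<le> 4 * B / norm z" by (simp add: mult.commute)
    qed (use B in auto)
    have "g z - g2 z = - J (3/2) z" using z by (simp add: g2_def)
    then have "norm (g z - g2 z) = norm (contour_integral (circlepath 0 (3/2)) (\<lambda>u. g u / (u - z))) / (2 * pi)"
      by (simp add: J_def norm_divide norm_mult)
    also have "\<dots> \<le> (4 * B / norm z) * (2 * pi * (3/2)) / (2 * pi)"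
      by (intro divide_right_mono bound) auto
    also have "\<dots> = 6 * B / norm z" by (simp add: field_simps)
    finally show "norm (g z - g2 z) \<le> 6 * B / norm z" .
  qed
qed

text \<open>
  On each ray \<open>|p|\<^sup>2 / t\<^sup>2\<^sup>M\<close> is nonincreasing as soon as \<open>M \<ge> C\<close>. Working with \<open>p\<close>
  instead of its logarithm makes it irrelevant how often \<open>p\<close> winds around the origin.
\<close>
lemma polynomial_growth_of_log_derivative_bound:
  fixes p d :: "complex \<Rightarrow> complex"
  assumes p: "\<And>z. 1 < norm z \<Longrightarrow> (p has_field_derivative d z * p z) (at z)"
    and d: "\<And>z. 2 \<le> norm z \<Longrightarrow> norm (d z) \<le> C / norm z" and "C \<ge> 0"
  obtains K and M :: nat where "K > 0" "\<And>z. 2 \<le> norm z \<Longrightarrow> norm (p z) \<le> K * norm z ^ M"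
proof -
  define M where "M = nat \<lceil>C\<rceil>"
  have M: "C \<le> real M" unfolding M_def by linarith
  have "continuous_on (sphere 0 2) p"
    by (rule DERIV_continuous_on[where D="\<lambda>z. d z * p z"], rule has_field_derivative_at_within, rule p) auto
  from continuous_on_compact_bound[OF compact_sphere this]
  obtain B0 where B0: "B0 \<ge> 0" "\<And>u. u \<in> sphere 0 2 \<Longrightarrow> norm (p u) \<le> B0" by blast
  define B where "B = B0 + 1"
  have B: "B > 0" "\<And>u. u \<in> sphere 0 2 \<Longrightarrow> norm (p u) \<le> B"
    unfolding B_def using B0(1) B0(2) by (fastforce intro: order_trans)+
  show ?thesis
  proof (rule that[of B M])
    fix z :: complex assume z: "2 \<le> norm z"
    define e where "e = z / of_real (norm z)"
    have e: "norm e = 1" "z = norm z * e" using z by (auto simp: e_def norm_divide)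
    define q where "q t = p (of_real t * e)" for t :: real
    \<comment> \<open>The square of the norm is used because, unlike the norm, it is differentiable at zeros.\<close>
    define \<phi> where "\<phi> t = (q t \<bullet> q t) / t ^ (2 * M)" for t :: real
    have "\<phi> (norm z) \<le> \<phi> 2"
    proof (rule DERIV_nonpos_imp_nonincreasing[OF z])
      fix t :: real assume t: "2 \<le> t" "t \<le> norm z"
      define w where "w = of_real t * e"
      have nw: "norm w = t" using t e by (simp add: w_def norm_mult)
      have "((\<lambda>t. of_real t * e) has_vector_derivative e) (at t)"
        by (auto intro!: derivative_eq_intros simp: has_vector_derivative_def scaleR_conv_of_real)
      then have "(q has_vector_derivative (e * (d w * p w))) (at t)"
        unfolding q_def using field_vector_diff_chain_at[of "\<lambda>t. of_real t * e" e t p "d w * p w"] p[of w] nw t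
        by (auto simp: w_def o_def)
      then have q': "(q has_derivative (\<lambda>x. x *\<^sub>R (e * (d w * q t)))) (at t)"
        by (simp add: has_vector_derivative_def w_def q_def)
      define D where "D = (2 * (q t \<bullet> (e * (d w * q t))) * t ^ (2*M) - (q t \<bullet> q t) * (of_nat (2*M) * t ^ (2*M-1))) / (t ^ (2*M)) ^ 2"
      have "((\<lambda>t. q t \<bullet> q t) has_real_derivative 2 * (q t \<bullet> (e * (d w * q t)))) (at t)"
        unfolding has_field_derivative_def
        by (rule has_derivative_eq_rhs[OF has_derivative_inner[OF q' q']])
           (auto simp: inner_commute fun_eq_iff)
      then have "(\<phi> has_real_derivative D) (at t)"
        unfolding \<phi>_def D_def using t
        by (auto intro!: derivative_eq_intros simp: power2_eq_square)
      moreover have "D \<le> 0"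
      proof -
        have "q t \<bullet> (e * (d w * q t)) \<le> norm (q t) * norm (e * (d w * q t))"
          by (rule norm_cauchy_schwarz)
        also have "\<dots> = norm (d w) * (q t \<bullet> q t)"
          by (simp add: norm_mult e dot_square_norm power2_eq_square)
        also have "\<dots> \<le> (M / t) * (q t \<bullet> q t)"
        proof (rule mult_right_mono)
          have "norm (d w) \<le> C / t" using d[of w] nw t by simp
          also have "\<dots> \<le> M / t" using M t by (simp add: divide_right_mono)
          finally show "norm (d w) \<le> M / t" .
        qed simp
        finally have "2 * (q t \<bullet> (e * (d w * q t))) * t ^ (2*M) \<le> 2 * ((M / t) * (q t \<bullet> q t)) * t ^ (2*M)"
          using t by (intro mult_right_mono mult_left_mono) auto
        also have "\<dots> = (q t \<bullet> q t) * (of_nat (2*M) * t ^ (2*M-1))"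
          using t by (cases M) (auto simp: field_simps)
        finally show ?thesis unfolding D_def by (intro divide_nonpos_nonneg) auto
      qed
      ultimately show "\<exists>y. (\<phi> has_real_derivative y) (at t) \<and> y \<le> 0" by blast
    qed
    moreover have "\<phi> (norm z) = (norm (p z) / norm z ^ M)^2"
      using e(2) by (simp add: \<phi>_def q_def dot_square_norm power_divide power_mult mult.commute power2_eq_square)
    moreover have "\<phi> 2 \<le> B^2"
    proof -
      have "norm (q 2) \<le> B" unfolding q_def using e by (intro B) (auto simp: norm_mult)
      then have "q 2 \<bullet> q 2 \<le> B^2" by (simp add: dot_square_norm power_mono)
      moreover have "q 2 \<bullet> q 2 / 2 ^ (2*M) \<le> q 2 \<bullet> q 2 / 1"
        by (intro frac_le) (auto)
      ultimately show ?thesis unfolding \<phi>_def by simp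
    qed
    ultimately have "(norm (p z) / norm z ^ M)^2 \<le> B^2" by linarith
    then have "norm (p z) / norm z ^ M \<le> B" by (rule power2_le_imp_le) (use B in simp)
    moreover have "norm z ^ M > 0" by (rule zero_less_power) (use z in linarith)
    ultimately show "norm (p z) \<le> B * norm z ^ M" by (simp add: pos_divide_le_eq)
  qed (use B in auto)
qed

text \<open>
  The quotient of \<open>f\<close> by \<open>exp G\<close> has the decaying part of \<open>f'/f\<close> as its logarithmic
  derivative, hence grows at most polynomially.
\<close>
lemma exterior_factorization:
  assumes f: "f holomorphic_on {\<zeta>. norm \<zeta> > 1}" and nz: "\<And>z. norm z > 1 \<Longrightarrow> f z \<noteq> 0"
  obtains G K and M :: nat where "G holomorphic_on UNIV" "K > 0"
    "\<And>z. norm z \<ge> 2 \<Longrightarrow> norm (f z) \<le> K * norm (z ^ M * exp (G z))"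
proof -
  have op: "open {\<zeta>::complex. norm \<zeta> > 1}" by (auto intro!: open_Collect_less continuous_intros)
  define g where "g z = deriv f z / f z" for z
  have g: "g holomorphic_on {\<zeta>. norm \<zeta> > 1}"
    unfolding g_def using nz by (intro holomorphic_intros f holomorphic_deriv[OF f op]) auto
  obtain g2 C where g2: "g2 holomorphic_on UNIV" and C: "C \<ge> 0" "\<And>z. norm z \<ge> 2 \<Longrightarrow> norm (g z - g2 z) \<le> C / norm z"
    using Laurent_split_exterior[OF g] by blast
  obtain G where G: "\<And>z. (G has_field_derivative g2 z) (at z)"
    using holomorphic_convex_primitive'[OF convex_UNIV open_UNIV g2] by auto
  define p where "p z = f z * exp (- G z)" for z
  have p': "(p has_field_derivative (g z - g2 z) * p z) (at z)" if z: "1 < norm z" for z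
  proof -
    have "(f has_field_derivative deriv f z) (at z)" using holomorphic_derivI[OF f op, of z] z by simp
    then show ?thesis
      unfolding p_def[abs_def] using nz[OF z]
      by (auto intro!: derivative_eq_intros G simp: g_def field_simps)
  qed
  obtain K and M :: nat where K: "K > 0" "\<And>z. 2 \<le> norm z \<Longrightarrow> norm (p z) \<le> K * norm z ^ M"
    using polynomial_growth_of_log_derivative_bound[OF p' C(2,1)] by blast
  show ?thesis
  proof (rule that[of G K M])
    show "G holomorphic_on UNIV" using G by (auto simp: holomorphic_on_open)
    fix z :: complex assume z: "norm z \<ge> 2"
    have "f z = p z * exp (G z)" by (simp add: p_def exp_minus)
    then have "norm (f z) = norm (p z) * norm (exp (G z))" by (simp only: norm_mult)
    also have "\<dots> \<le> K * norm z ^ M * norm (exp (G z))" by (intro mult_right_mono K z) auto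
    finally show "norm (f z) \<le> K * norm (z ^ M * exp (G z))"
      by (simp only: norm_mult norm_power mult.assoc)
  qed (rule K)
qed

section \<open>Logarithmic derivatives of univalent functions\<close>

text \<open>
  By Bloch's theorem the image of \<open>h\<close> contains a disc of radius \<open>r |h' a| / 12\<close>. If this
  exceeded \<open>\<pi>\<close>, the disc would contain two points that differ by \<open>2 \<pi> \<i>\<close>, and the
  exponential would identify them.
\<close>
lemma log_derivative_univalent_bound:
  assumes h: "h holomorphic_on ball a r" and "r > 0"
    and inj: "inj_on (\<lambda>w. exp (h w)) (ball a r)"
  shows "r * norm (deriv h a) \<le> 12 * pi"
proof (rule ccontr)
  assume "\<not> ?thesis"
  then have big: "pi < r * norm (deriv h a) / 12" by simp
  obtain b where b: "ball b (r * norm (deriv h a) / 12) \<subseteq> h ` ball a r"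
    using Bloch[OF h \<open>r > 0\<close> order_refl] by blast
  have "b + of_real pi * \<i> \<in> h ` ball a r" "b - of_real pi * \<i> \<in> h ` ball a r"
    using big by (auto intro!: subsetD[OF b] simp: dist_norm norm_mult)
  then obtain x y where xy: "x \<in> ball a r" "y \<in> ball a r"
      "h x = b + of_real pi * \<i>" "h y = b - of_real pi * \<i>"
    by (metis imageE)
  have "exp (h x) = exp (h y)"
    using exp_2pi_1_int[of 1] by (simp add: xy exp_add exp_diff)
  then have "x = y" using inj xy(1,2) by (auto dest: inj_onD)
  then have "Im (h x) = Im (h y)" by simp
  then show False by (simp add: xy)
qed

lemma nonvanishing_univalent_bound:
  assumes \<psi>: "\<psi> holomorphic_on ball a r" and r: "r > 0"
    and inj: "inj_on \<psi> (ball a r)" and nz: "\<And>w. w \<in> ball a r \<Longrightarrow> \<psi> w \<noteq> 0"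
  shows "r * norm (deriv \<psi> a / \<psi> a) \<le> 12 * pi"
proof -
  obtain h where h: "h holomorphic_on ball a r" "\<And>w. w \<in> ball a r \<Longrightarrow> exp (h w) = \<psi> w"
    using holomorphic_logarithm_exists[of "ball a r" \<psi> a] \<psi> nz r by auto
  have a: "a \<in> ball a r" using r by simp
  have "inj_on (\<lambda>w. exp (h w)) (ball a r)"
    using inj h(2) by (simp add: inj_on_def)
  then have "r * norm (deriv h a) \<le> 12 * pi"
    by (rule log_derivative_univalent_bound[OF h(1) r])
  moreover have "deriv \<psi> a = \<psi> a * deriv h a"
  proof (rule DERIV_imp_deriv)
    have "((\<lambda>w. exp (h w)) has_field_derivative exp (h a) * deriv h a) (at a)"
      by (intro DERIV_fun_exp holomorphic_derivI[OF h(1)] a) auto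
    then show "(\<psi> has_field_derivative \<psi> a * deriv h a) (at a)"
      using has_field_derivative_transform_within_open[OF _ open_ball a] h(2) a by fastforce
  qed
  ultimately show ?thesis using nz[OF a] by simp
qed

text \<open>
  The only zero of \<open>\<psi>\<close> is the origin, so the bound above on the ball of radius \<open>|w|\<close> about
  \<open>w\<close> shows that \<open>w \<psi>' w / \<psi> w\<close> is bounded; by Liouville's theorem it is constantly 1.
\<close>
lemma entire_injective_imp_linear:
  assumes \<psi>: "\<psi> holomorphic_on UNIV" and inj: "inj \<psi>" and \<psi>0: "\<psi> 0 = 0" and d: "deriv \<psi> 0 \<noteq> 0"
  obtains c where "c \<noteq> 0" "\<And>w. \<psi> w = c * w"
proof -
  define q where "q w = (if w = 0 then deriv \<psi> 0 else (\<psi> w - \<psi> 0) / (w - 0))" for w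
  have q: "q holomorphic_on UNIV"
    unfolding q_def by (rule pole_lemma_open[OF \<psi> open_UNIV])
  have \<psi>q: "\<psi> w = w * q w" for w by (simp add: q_def \<psi>0)
  have nz: "\<psi> w \<noteq> 0" if "w \<noteq> 0" for w using inj \<psi>0 that by (metis injD)
  have qnz: "q w \<noteq> 0" for w using nz[of w] d by (auto simp: q_def \<psi>0)
  have q': "(q has_field_derivative deriv q w) (at w)" for w
    by (rule holomorphic_derivI[OF q]) auto
  define h where "h w = w * deriv q w / q w" for w
  have h: "h holomorphic_on UNIV"
    unfolding h_def using qnz by (intro holomorphic_intros q holomorphic_deriv[OF q open_UNIV]) auto
  have "norm (h w) \<le> 12 * pi + 1" for w
  proof (cases "w = 0")
    case False
    have "(\<psi> has_field_derivative (q w + w * deriv q w)) (at w)"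
      unfolding \<psi>q[abs_def] by (auto intro!: derivative_eq_intros q')
    then have "deriv \<psi> w = q w + w * deriv q w" by (rule DERIV_imp_deriv)
    then have eq: "h w = w * (deriv \<psi> w / \<psi> w) - 1"
      using False qnz[of w] by (simp add: h_def \<psi>q field_simps)
    have "norm w * norm (deriv \<psi> w / \<psi> w) \<le> 12 * pi"
    proof (rule nonvanishing_univalent_bound)
      show "\<psi> holomorphic_on ball w (norm w)" using \<psi> by (rule holomorphic_on_subset) simp
      show "inj_on \<psi> (ball w (norm w))" using inj by (rule inj_on_subset) simp
      show "\<psi> x \<noteq> 0" if "x \<in> ball w (norm w)" for x using that by (intro nz) auto
    qed (use False in auto)
    then have "norm (w * (deriv \<psi> w / \<psi> w)) \<le> 12 * pi" by (simp only: norm_mult)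
    then show ?thesis unfolding eq by (intro order_trans[OF norm_triangle_ineq4]) simp
  qed (simp add: h_def)
  then have "bounded (range h)" by (auto simp: bounded_iff)
  from Liouville_theorem[OF h this] have hc: "h w = h 0" for w
    by (metis UNIV_I constant_on_def)
  have "deriv q w = 0" if "w \<noteq> 0" for w
    using hc[of w] that qnz[of w] by (simp add: h_def)
  then have "\<And>x. x \<in> UNIV - {0} \<Longrightarrow> (q has_field_derivative 0) (at x)"
    using q' by (metis Diff_iff singletonI)
  then obtain c where "\<And>w. q w = c"
    using DERIV_zero_connected_constant[of UNIV "{0}" q] holomorphic_on_imp_continuous_on[OF q] by auto
  then show ?thesis using that[of c] \<psi>q qnz by (metis mult.commute)
qed

section \<open>Analytic continuation of lifts\<close>

text \<open>
  Where \<open>F\<close> is locally injective, two lifts that meet must coincide nearby; the identity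
  theorem does the rest. This serves twice: for the injectivity of the inverse branch and
  for matching its continuations.
\<close>
lemma holomorphic_lift_unique:
  assumes F: "F holomorphic_on T" "open T"
    and \<alpha>: "\<alpha> holomorphic_on S" and \<beta>: "\<beta> holomorphic_on S" and S: "open S" "connected S"
    and eq: "\<And>w. w \<in> S \<Longrightarrow> F (\<alpha> w) = F (\<beta> w)"
    and p: "p \<in> S" "\<alpha> p = \<beta> p" "\<alpha> p \<in> T" "deriv F (\<alpha> p) \<noteq> 0" and z: "z \<in> S"
  shows "\<alpha> z = \<beta> z"
proof -
  obtain r where r: "r > 0" "inj_on F (ball (\<alpha> p) r)"
    using has_complex_derivative_locally_injective[OF F(1) p(3) F(2) p(4)] by blast
  define U where "U = (S \<inter> \<alpha> -` ball (\<alpha> p) r) \<inter> (S \<inter> \<beta> -` ball (\<alpha> p) r)"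
  have "open U" unfolding U_def
    by (intro open_Int continuous_open_preimage holomorphic_on_imp_continuous_on \<alpha> \<beta> S open_ball)
  moreover have "U \<noteq> {}" using p r by (auto simp: U_def)
  moreover have "U \<subseteq> S" by (auto simp: U_def)
  moreover have "\<alpha> w = \<beta> w" if "w \<in> U" for w
    using that r(2) eq[of w] by (auto simp: U_def inj_on_def)
  ultimately show ?thesis
    using analytic_continuation_open[of U S \<alpha> \<beta> z] \<alpha> \<beta> S z by blast
qed

text \<open>
  Two of the boundary discs that overlap also overlap inside \<open>ball 0 R\<close>, because the chord
  between their centres lies there. As their intersection is convex, the local extensions
  are therefore consistent, and compactness of the circle gives a larger concentric disc.
\<close>
lemma holomorphic_extend_across_sphere:
  fixes \<psi> :: "complex \<Rightarrow> complex"
  assumes \<psi>: "\<psi> holomorphic_on ball 0 R" and R: "R > 0"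
    and ext: "\<And>\<xi>. norm \<xi> = R \<Longrightarrow> \<exists>\<delta>>0. \<exists>\<kappa>. \<kappa> holomorphic_on ball \<xi> \<delta> \<and>
                 (\<forall>w\<in>ball \<xi> \<delta> \<inter> ball 0 R. \<kappa> w = \<psi> w)"
  obtains R' \<Psi> where "R' > R" "\<Psi> holomorphic_on ball 0 R'" "\<And>w. w \<in> ball 0 R \<Longrightarrow> \<Psi> w = \<psi> w"
proof -
  obtain \<delta> \<kappa> where \<delta>: "\<And>\<xi>. norm \<xi> = R \<Longrightarrow> \<delta> \<xi> > 0"
    and \<kappa>: "\<And>\<xi>. norm \<xi> = R \<Longrightarrow> \<kappa> \<xi> holomorphic_on ball \<xi> (\<delta> \<xi>)"
    and \<kappa>\<psi>: "\<And>\<xi> w. norm \<xi> = R \<Longrightarrow> w \<in> ball \<xi> (\<delta> \<xi>) \<Longrightarrow> w \<in> ball 0 R \<Longrightarrow> \<kappa> \<xi> w = \<psi> w"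
    using ext by (metis IntI)
  have agree: "\<kappa> \<xi> w = \<kappa> \<eta> w"
    if \<xi>: "norm \<xi> = R" "w \<in> ball \<xi> (\<delta> \<xi>)" and \<eta>: "norm \<eta> = R" "w \<in> ball \<eta> (\<delta> \<eta>)" for \<xi> \<eta> w
  proof (cases "\<xi> = \<eta>")
    case False
    define I where "I = ball \<xi> (\<delta> \<xi>) \<inter> ball \<eta> (\<delta> \<eta>)"
    have len: "dist \<xi> \<eta> < \<delta> \<xi> + \<delta> \<eta>"
      using \<xi> \<eta> dist_triangle_half_l dist_triangle2[of \<xi> \<eta> w] by (auto simp: dist_commute)
    \<comment> \<open>This weight splits the chord in the ratio of the two radii, so that \<open>m\<close> lies in both discs.\<close>
    define s where "s = \<delta> \<xi> / (\<delta> \<xi> + \<delta> \<eta>)"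
    have s: "0 < s" "s < 1" "1 - s = \<delta> \<eta> / (\<delta> \<xi> + \<delta> \<eta>)"
      using \<delta>[OF \<xi>(1)] \<delta>[OF \<eta>(1)] by (auto simp: s_def field_simps)
    define m where "m = (1 - s) *\<^sub>R \<xi> + s *\<^sub>R \<eta>"
    have "dist \<xi> m = s * dist \<xi> \<eta>"
    proof -
      have "\<xi> - m = s *\<^sub>R (\<xi> - \<eta>)" by (simp add: m_def algebra_simps)
      then show ?thesis using s by (simp add: dist_norm)
    qed
    also have "\<dots> < s * (\<delta> \<xi> + \<delta> \<eta>)" using len s by (intro mult_strict_left_mono) auto
    also have "\<dots> = \<delta> \<xi>" using \<delta>[OF \<xi>(1)] \<delta>[OF \<eta>(1)] by (simp add: s_def)
    finally have m1: "m \<in> ball \<xi> (\<delta> \<xi>)" by simp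
    have "dist \<eta> m = (1 - s) * dist \<xi> \<eta>"
    proof -
      have "\<eta> - m = (1 - s) *\<^sub>R (\<eta> - \<xi>)" by (simp add: m_def algebra_simps)
      then show ?thesis using s(1,2) by (simp add: dist_norm norm_minus_commute)
    qed
    also have "\<dots> < (1 - s) * (\<delta> \<xi> + \<delta> \<eta>)" using len s by (intro mult_strict_left_mono) auto
    also have "\<dots> = \<delta> \<eta>" using \<delta>[OF \<xi>(1)] \<delta>[OF \<eta>(1)] s(3) by simp
    finally have m2: "m \<in> ball \<eta> (\<delta> \<eta>)" by simp
    have "m \<in> open_segment \<xi> \<eta>" using s False by (auto simp: in_segment m_def)
    then have m3: "m \<in> ball 0 R"
      using dist_decreases_open_segment[of m \<xi> \<eta> 0] \<xi> \<eta> by (auto simp: dist_norm)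
    show ?thesis
    proof (rule analytic_continuation_open[of "I \<inter> ball 0 R" I "\<kappa> \<xi>" "\<kappa> \<eta>" w])
      show "connected I" unfolding I_def by (intro convex_connected convex_Int convex_ball)
      show "I \<inter> ball 0 R \<noteq> {}" using m1 m2 m3 by (auto simp: I_def)
      show "\<kappa> \<xi> holomorphic_on I" "\<kappa> \<eta> holomorphic_on I"
        using \<kappa>[OF \<xi>(1)] \<kappa>[OF \<eta>(1)] by (auto simp: I_def intro: holomorphic_on_subset)
      show "w \<in> I" using \<xi> \<eta> by (simp add: I_def)
      show "\<kappa> \<xi> z = \<kappa> \<eta> z" if "z \<in> I \<inter> ball 0 R" for z
        using that \<kappa>\<psi>[OF \<xi>(1)] \<kappa>\<psi>[OF \<eta>(1)] by (auto simp: I_def)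
    qed (auto simp: I_def)
  qed simp
  define V where "V = (\<Union>\<xi>\<in>sphere (0::complex) R. ball \<xi> (\<delta> \<xi>))"
  define c where "c w = (SOME \<xi>::complex. norm \<xi> = R \<and> w \<in> ball \<xi> (\<delta> \<xi>))" for w
  have c: "norm (c w) = R \<and> w \<in> ball (c w) (\<delta> (c w))" if "w \<in> V" for w
    unfolding c_def by (rule someI_ex) (use that in \<open>auto simp: V_def\<close>)
  have "(\<lambda>w. \<kappa> (c w) w) holomorphic_on V"
    unfolding V_def
  proof (rule holomorphic_on_UN_open)
    fix \<xi> :: complex assume \<xi>: "\<xi> \<in> sphere 0 R"
    have "(\<lambda>w. \<kappa> (c w) w) holomorphic_on ball \<xi> (\<delta> \<xi>) \<longleftrightarrow> \<kappa> \<xi> holomorphic_on ball \<xi> (\<delta> \<xi>)"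
    proof (rule holomorphic_cong[OF refl])
      fix w assume w: "w \<in> ball \<xi> (\<delta> \<xi>)"
      have "w \<in> V" unfolding V_def using \<xi> w by blast
      from c[OF this] \<xi> w show "\<kappa> (c w) w = \<kappa> \<xi> w" by (intro agree) auto
    qed
    moreover have "\<kappa> \<xi> holomorphic_on ball \<xi> (\<delta> \<xi>)" by (rule \<kappa>) (use \<xi> in simp)
    ultimately show "(\<lambda>w. \<kappa> (c w) w) holomorphic_on ball \<xi> (\<delta> \<xi>)" by blast
  qed auto
  then have hol: "(\<lambda>w. if w \<in> ball 0 R then \<psi> w else \<kappa> (c w) w) holomorphic_on ball 0 R \<union> V"
  proof (rule holomorphic_on_If_Un[OF \<psi>])
    show "open V" unfolding V_def by blast
    fix w assume "w \<in> ball 0 R" "w \<in> V"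
    with c[of w] show "\<psi> w = \<kappa> (c w) w" by (intro \<kappa>\<psi>[symmetric]) auto
  qed auto
  have "cball 0 R \<subseteq> ball 0 R \<union> V"
  proof
    fix w :: complex assume "w \<in> cball 0 R"
    moreover have "w \<in> V" if "norm w = R"
      unfolding V_def by (rule UN_I[of w]) (use that \<delta>[OF that] in auto)
    ultimately show "w \<in> ball 0 R \<union> V" by (cases "norm w = R") auto
  qed
  moreover have "open (ball 0 R \<union> V)" by (auto simp: V_def)
  ultimately obtain e where e: "e > 0" "(\<Union>x\<in>cball 0 R. ball x e) \<subseteq> ball 0 R \<union> V"
    using compact_subset_open_imp_ball_epsilon_subset[OF compact_cball] by blast
  have sub: "ball 0 (R + e) \<subseteq> ball 0 R \<union> V"
  proof
    fix w :: complex assume w: "w \<in> ball 0 (R + e)"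
    show "w \<in> ball 0 R \<union> V"
    proof (cases "norm w < R")
      case False
      define x where "x = (R / norm w) *\<^sub>R w"
      have nw: "norm w > 0" using False R by linarith
      have "norm x = R" using R nw by (simp add: x_def)
      have "w - x = (1 - R / norm w) *\<^sub>R w" by (simp add: x_def algebra_simps)
      then have "dist x w = \<bar>1 - R / norm w\<bar> * norm w" by (simp add: dist_norm norm_minus_commute)
      moreover have "R / norm w \<le> 1" using False nw by simp
      ultimately have "dist x w = norm w - R" using nw by (simp add: left_diff_distrib)
      with \<open>norm x = R\<close> w have "x \<in> cball 0 R" "w \<in> ball x e" by auto
      then show ?thesis using e(2) by blast
    qed simp
  qed
  show ?thesis
    by (rule that[of "R + e" "\<lambda>w. if w \<in> ball 0 R then \<psi> w else \<kappa> (c w) w"])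
       (use e holomorphic_on_subset[OF hol sub] in auto)
qed

section \<open>The maximal disc of an inverse branch\<close>

text \<open>
  Write \<open>F\<close> near its zero as \<open>z\<^sup>m g z\<close> with \<open>g\<close> nonvanishing. An \<open>m\<close>-th root of \<open>g\<close>
  exists on a disc, so \<open>F\<close> is the \<open>m\<close>-th power of a function with nonzero derivative,
  whose local inverse is \<open>\<psi>\<close>.
\<close>
lemma power_inverse_at_zero:
  assumes F: "F holomorphic_on UNIV" and F0: "F 0 = 0" and nc: "\<not> F constant_on UNIV"
  obtains m \<delta> \<psi> where "0 < (m::nat)" "\<delta> > 0" "\<psi> holomorphic_on ball 0 \<delta>" "\<psi> 0 = 0" "deriv \<psi> 0 \<noteq> 0"
    "\<And>w. w \<in> ball 0 \<delta> \<Longrightarrow> F (\<psi> w) = w ^ m"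
proof -
  obtain g r m where m: "0 < m" and r: "0 < r" and g: "g holomorphic_on ball 0 r"
    and Fg: "\<And>w. w \<in> ball 0 r \<Longrightarrow> F w = (w - 0) ^ m * g w"
    and g0: "\<And>w. w \<in> ball 0 r \<Longrightarrow> g w \<noteq> 0"
    using holomorphic_factor_zero_nonconstant[OF F open_UNIV connected_UNIV UNIV_I F0 nc] by metis
  obtain l where l: "l holomorphic_on ball 0 r" "\<And>w. w \<in> ball 0 r \<Longrightarrow> exp (l w) = g w"
    using holomorphic_logarithm_exists[of "ball 0 r" g 0] g g0 r by auto
  define \<Phi> where "\<Phi> w = w * exp (l w / of_nat m)" for w
  have \<Phi>: "\<Phi> holomorphic_on ball 0 r"
    unfolding \<Phi>_def using m by (intro holomorphic_intros l) auto
  have F\<Phi>: "\<Phi> w ^ m = F w" if "w \<in> ball 0 r" for w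
  proof -
    have "exp (l w / of_nat m) ^ m = exp (of_nat m * (l w / of_nat m))"
      by (rule exp_of_nat_mult[symmetric])
    then show ?thesis
      using that m Fg l(2) by (simp add: \<Phi>_def power_mult_distrib)
  qed
  have [simp]: "0 \<in> ball (0::complex) r" using r by simp
  have "(\<Phi> has_field_derivative exp (l 0 / of_nat m)) (at 0)"
  proof -
    have "(l has_field_derivative deriv l 0) (at 0)"
      by (rule holomorphic_derivI[OF l(1)]) (use r in auto)
    then show ?thesis
      unfolding \<Phi>_def using m by (auto intro!: derivative_eq_intros)
  qed
  then have d: "deriv \<Phi> 0 \<noteq> 0" by (simp add: DERIV_imp_deriv)
  obtain \<rho> where \<rho>: "\<rho> > 0" "ball (0::complex) \<rho> \<subseteq> ball 0 r" "open (\<Phi> ` ball 0 \<rho>)" "inj_on \<Phi> (ball 0 \<rho>)"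
    using has_complex_derivative_locally_invertible[OF \<Phi> \<open>0 \<in> ball 0 r\<close> open_ball d] by blast
  have hol: "\<Phi> holomorphic_on ball 0 \<rho>" using \<Phi> \<rho>(2) by (rule holomorphic_on_subset)
  obtain \<psi> where \<psi>: "\<psi> holomorphic_on (\<Phi> ` ball 0 \<rho>)"
      "\<And>z. z \<in> ball 0 \<rho> \<Longrightarrow> deriv \<Phi> z * deriv \<psi> (\<Phi> z) = 1"
      "\<And>z. z \<in> ball 0 \<rho> \<Longrightarrow> \<psi> (\<Phi> z) = z"
    by (rule holomorphic_has_inverse[OF hol open_ball \<rho>(4)]) blast
  have \<Phi>0: "\<Phi> 0 = 0" by (simp add: \<Phi>_def)
  then have "0 \<in> \<Phi> ` ball 0 \<rho>" using \<rho>(1) by (metis centre_in_ball imageI)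
  then obtain \<delta> where \<delta>: "\<delta> > 0" "ball 0 \<delta> \<subseteq> \<Phi> ` ball 0 \<rho>"
    using \<rho>(3) openE by blast
  show ?thesis
  proof (rule that[OF m \<delta>(1)])
    show "\<psi> holomorphic_on ball 0 \<delta>" using \<psi>(1) \<delta>(2) by (rule holomorphic_on_subset)
    show "\<psi> 0 = 0" using \<psi>(3)[of 0] \<rho>(1) \<Phi>0 by simp
    show "deriv \<psi> 0 \<noteq> 0" using \<psi>(2)[of 0] \<rho>(1) \<Phi>0 by auto
    fix w :: complex assume "w \<in> ball 0 \<delta>"
    then obtain z where z: "z \<in> ball 0 \<rho>" "w = \<Phi> z" using \<delta>(2) by blast
    then show "F (\<psi> w) = w ^ m" using \<psi>(3)[of z] F\<Phi>[of z] \<rho>(2) by auto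
  qed
qed

lemma power_inverse_nonzero:
  fixes F :: "complex \<Rightarrow> complex"
  assumes F0: "F 0 = 0" and eq: "F z = w ^ m" and "w \<noteq> 0"
  shows "z \<noteq> 0"
  using assms by auto

text \<open>
  If \<open>\<psi> x = \<psi> y\<close>, then \<open>y = \<omega> x\<close> with an \<open>m\<close>-th root of unity \<open>\<omega>\<close>. Both \<open>\<psi> w\<close> and
  \<open>\<psi> (\<omega> w)\<close> are lifts of \<open>w\<^sup>m\<close> and they agree at \<open>x\<close>, so they agree everywhere;
  comparing derivatives at the origin gives \<open>\<omega> = 1\<close>.
\<close>
lemma power_inverse_inj_on:
  assumes F: "F holomorphic_on UNIV" and F0: "F 0 = 0" and dF: "\<And>z. z \<noteq> 0 \<Longrightarrow> deriv F z \<noteq> 0"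
    and m: "0 < (m::nat)" and r: "r > 0" and \<psi>: "\<psi> holomorphic_on ball 0 r" and d: "deriv \<psi> 0 \<noteq> 0"
    and eq: "\<And>w. w \<in> ball 0 r \<Longrightarrow> F (\<psi> w) = w ^ m"
  shows "inj_on \<psi> (ball 0 r)"
proof (rule inj_onI)
  fix x y assume x: "x \<in> ball 0 r" and y: "y \<in> ball 0 r" and xy: "\<psi> x = \<psi> y"
  have pow: "x ^ m = y ^ m" using eq[OF x] eq[OF y] xy by simp
  show "x = y"
  proof (cases "x = 0")
    case True
    then show ?thesis using pow m by (simp add: power_0_left)
  next
    case False
    define \<omega> where "\<omega> = y / x"
    have y\<omega>: "y = \<omega> * x" using False by (simp add: \<omega>_def)
    have \<omega>m: "\<omega> ^ m = 1" unfolding \<omega>_def power_divide pow[symmetric] using False by simp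
    then have n\<omega>: "norm \<omega> = 1" using m
      by (metis norm_one norm_power norm_ge_zero power_eq_1_iff nat_neq_iff)
    have inb: "\<omega> * w \<in> ball 0 r" if "w \<in> ball 0 r" for w using that n\<omega> by (simp add: norm_mult)
    have hol: "(\<lambda>w. \<psi> (\<omega> * w)) holomorphic_on ball 0 r"
      by (rule holomorphic_on_compose_gen[OF _ \<psi>, unfolded o_def])
         (use inb in \<open>auto intro!: holomorphic_intros\<close>)
    have same: "\<psi> w = \<psi> (\<omega> * w)" if "w \<in> ball 0 r" for w
    proof (rule holomorphic_lift_unique[OF F open_UNIV \<psi> hol open_ball connected_ball _ x _ _ _ that])
      show "F (\<psi> w) = F (\<psi> (\<omega> * w))" if "w \<in> ball 0 r" for w
        using eq[OF that] eq[OF inb[OF that]] \<omega>m by (simp add: power_mult_distrib)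
      show "\<psi> x = \<psi> (\<omega> * x)" using xy y\<omega> by simp
      show "deriv F (\<psi> x) \<noteq> 0" by (intro dF power_inverse_nonzero[OF F0 eq[OF x] False])
    qed auto
    have "(\<psi> has_field_derivative deriv \<psi> 0) (at (\<omega> * 0))"
      using holomorphic_derivI[OF \<psi> open_ball, of 0] r by simp
    then have "((\<lambda>w. \<psi> (\<omega> * w)) has_field_derivative deriv \<psi> 0 * \<omega>) (at 0)"
      by (rule DERIV_chain2) (auto intro!: derivative_eq_intros)
    then have "(\<psi> has_field_derivative deriv \<psi> 0 * \<omega>) (at 0)"
      by (rule has_field_derivative_transform_within_open[OF _ open_ball[of 0 r]]) (use r same in auto)
    then have "deriv \<psi> 0 = deriv \<psi> 0 * \<omega>" by (rule DERIV_imp_deriv)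
    then show "x = y" using d y\<omega> by simp
  qed
qed

text \<open>
  If \<open>\<psi>\<close> does not escape to infinity along the radius to \<open>\<xi>\<close>, it accumulates at a point
  \<open>z1\<close> with \<open>F z1 = \<xi>\<^sup>m \<noteq> 0\<close>. There \<open>F\<close> is locally invertible, and composing the local
  inverse with the \<open>m\<close>-th power continues \<open>\<psi>\<close> across \<open>\<xi>\<close>.
\<close>
lemma power_inverse_extends:
  assumes F: "F holomorphic_on UNIV" and F0: "F 0 = 0" and dF: "\<And>z. z \<noteq> 0 \<Longrightarrow> deriv F z \<noteq> 0"
    and m: "0 < (m::nat)" and \<psi>: "\<psi> holomorphic_on ball 0 R" 
    and eq: "\<And>w. w \<in> ball 0 R \<Longrightarrow> F (\<psi> w) = w ^ m"
    and \<xi>: "norm \<xi> = R" "R > 0"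
    and nlim: "\<not> filterlim (\<lambda>s. norm (\<psi> (of_real s * \<xi>))) at_top (at_left 1)"
  shows "\<exists>\<delta>>0. \<exists>\<kappa>. \<kappa> holomorphic_on ball \<xi> \<delta> \<and> (\<forall>w\<in>ball \<xi> \<delta> \<inter> ball 0 R. \<kappa> w = \<psi> w)"
proof -
  obtain B where B: "\<exists>\<^sub>F s in at_left 1. norm (\<psi> (of_real s * \<xi>)) < B"
    using nlim by (auto simp: filterlim_at_top not_eventually not_le)
  have "\<exists>s. 0 < s \<and> 1 - 1 / real (Suc n) < s \<and> s < 1 \<and> norm (\<psi> (of_real s * \<xi>)) < B" for n
  proof -
    have "\<forall>\<^sub>F s in at_left (1::real). max 0 (1 - 1 / real (Suc n)) < s \<and> s < 1"
      using eventually_at_left_real[of "max 0 (1 - 1 / real (Suc n))" 1]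
      by (auto elim!: eventually_mono)
    from frequently_ex[OF frequently_eventually_frequently[OF B this]]
    show ?thesis unfolding max_less_iff_conj by blast
  qed
  then obtain s where s: "\<And>n. 0 < s n" "\<And>n. 1 - 1 / real (Suc n) < s n" "\<And>n. s n < 1"
      "\<And>n. norm (\<psi> (of_real (s n) * \<xi>)) < B"
    by metis
  have s1: "s \<longlonglongrightarrow> 1"
  proof (rule tendsto_sandwich[of "\<lambda>n. 1 - 1 / real (Suc n)" _ _ "\<lambda>_. 1"])
    have "(\<lambda>n. 1 - 1 / real (Suc n)) \<longlonglongrightarrow> 1 - 0"
      by (intro tendsto_intros LIMSEQ_Suc[OF lim_1_over_n])
    then show "(\<lambda>n. 1 - 1 / real (Suc n)) \<longlonglongrightarrow> 1" by simp
  qed (use s(2,3) in \<open>auto intro!: always_eventually less_imp_le\<close>)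
  have "\<forall>n. \<psi> (of_real (s n) * \<xi>) \<in> cball 0 B" using s(4) by (auto intro: less_imp_le)
  then obtain z1 \<sigma> where \<sigma>: "strict_mono \<sigma>" "((\<lambda>n. \<psi> (of_real (s n) * \<xi>)) \<circ> \<sigma>) \<longlonglongrightarrow> z1"
    using compact_cball[of "0::complex" B] unfolding compact_def by meson
  define p where "p n = of_real (s (\<sigma> n)) * \<xi>" for n
  have p\<xi>: "p \<longlonglongrightarrow> \<xi>"
  proof -
    have "p \<longlonglongrightarrow> of_real 1 * \<xi>"
      unfolding p_def by (intro tendsto_intros LIMSEQ_subseq_LIMSEQ[OF s1 \<sigma>(1), unfolded o_def])
    then show ?thesis by simp
  qed
  have pb: "p n \<in> ball 0 R" "p n \<noteq> 0" for n
    using s(1,3)[of "\<sigma> n"] \<xi> by (auto simp: p_def norm_mult)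
  have \<psi>p: "(\<lambda>n. \<psi> (p n)) \<longlonglongrightarrow> z1" using \<sigma>(2) by (simp add: p_def o_def)
  have contF: "isCont F z1"
    using holomorphic_on_imp_continuous_on[OF F] by (simp add: continuous_on_eq_continuous_at)
  have "(\<lambda>n. F (\<psi> (p n))) \<longlonglongrightarrow> F z1" by (rule isCont_tendsto_compose[OF contF \<psi>p])
  moreover have "(\<lambda>n. F (\<psi> (p n))) = (\<lambda>n. p n ^ m)" using eq pb by auto
  moreover have "(\<lambda>n. p n ^ m) \<longlonglongrightarrow> \<xi> ^ m" by (intro tendsto_intros p\<xi>)
  ultimately have Fz1: "F z1 = \<xi> ^ m" by (metis LIMSEQ_unique)
  have z1: "z1 \<noteq> 0" using Fz1 F0 \<xi> by auto
  obtain r where r: "r > 0" "open (F ` ball z1 r)" "inj_on F (ball z1 r)"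
    using has_complex_derivative_locally_invertible[OF F UNIV_I open_UNIV dF[OF z1]] by blast
  have hol: "F holomorphic_on ball z1 r" using F by (rule holomorphic_on_subset) simp
  obtain g where g: "g holomorphic_on (F ` ball z1 r)" "\<And>z. z \<in> ball z1 r \<Longrightarrow> g (F z) = z"
    by (rule holomorphic_has_inverse[OF hol open_ball r(3)]) blast
  have "open ((\<lambda>w. w ^ m) -` (F ` ball z1 r))"
    by (intro continuous_open_vimage r(2) continuous_intros)
  moreover have "\<xi> \<in> (\<lambda>w. w ^ m) -` (F ` ball z1 r)" using Fz1 r(1) by (metis centre_in_ball imageI vimageI)
  ultimately obtain \<delta> where \<delta>: "\<delta> > 0" "ball \<xi> \<delta> \<subseteq> (\<lambda>w. w ^ m) -` (F ` ball z1 r)"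
    using openE by blast
  define \<kappa> where "\<kappa> w = g (w ^ m)" for w
  have \<kappa>: "\<kappa> holomorphic_on ball \<xi> \<delta>"
    unfolding \<kappa>_def by (rule holomorphic_on_compose_gen[OF _ g(1), unfolded o_def])
      (use \<delta>(2) in \<open>auto intro!: holomorphic_intros\<close>)
  have F\<kappa>: "F (\<kappa> w) = w ^ m" if "w \<in> ball \<xi> \<delta>" for w
  proof -
    from that \<delta>(2) obtain u where "u \<in> ball z1 r" "w ^ m = F u" by blast
    then show ?thesis by (simp add: \<kappa>_def g(2))
  qed
  have "\<forall>\<^sub>F n in sequentially. \<psi> (p n) \<in> ball z1 r"
    by (rule topological_tendstoD[OF \<psi>p]) (use r in auto)
  moreover have "\<forall>\<^sub>F n in sequentially. p n \<in> ball \<xi> \<delta>"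
    by (rule topological_tendstoD[OF p\<xi>]) (use \<delta> in auto)
  ultimately obtain n where n: "\<psi> (p n) \<in> ball z1 r" "p n \<in> ball \<xi> \<delta>"
    using eventually_happens'[OF sequentially_bot eventually_conj] by blast
  have "\<psi> w = \<kappa> w" if "w \<in> ball \<xi> \<delta> \<inter> ball 0 R" for w
  proof (rule holomorphic_lift_unique[OF F open_UNIV _ _ _ _ _ _ _ _ _ that])
    show "\<psi> holomorphic_on ball \<xi> \<delta> \<inter> ball 0 R" using \<psi> by (rule holomorphic_on_subset) simp
    show "\<kappa> holomorphic_on ball \<xi> \<delta> \<inter> ball 0 R" using \<kappa> by (rule holomorphic_on_subset) simp
    show "connected (ball \<xi> \<delta> \<inter> ball 0 R)" by (intro convex_connected convex_Int convex_ball)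
    show "F (\<psi> w) = F (\<kappa> w)" if "w \<in> ball \<xi> \<delta> \<inter> ball 0 R" for w
      using that eq F\<kappa> by simp
    show "p n \<in> ball \<xi> \<delta> \<inter> ball 0 R" using n pb by simp
    show "\<psi> (p n) = \<kappa> (p n)" using g(2)[OF n(1)] eq[OF pb(1)] by (simp add: \<kappa>_def)
    show "deriv F (\<psi> (p n)) \<noteq> 0" by (intro dF power_inverse_nonzero[OF F0 eq pb(2)] pb)
  qed auto
  then show ?thesis using \<delta>(1) \<kappa> by metis
qed

text \<open>
  The inverse branch is represented by its Taylor series, which makes the maximal disc the
  disc of convergence: a holomorphic extension to a larger disc would increase the
  radius of convergence.
\<close>
lemma power_inverse_maximal_disc:
  assumes F: "F holomorphic_on UNIV" and F0: "F 0 = 0" and dF: "\<And>z. z \<noteq> 0 \<Longrightarrow> deriv F z \<noteq> 0"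
    and nc: "\<not> F constant_on UNIV"
  obtains (entire) m \<psi> where "0 < (m::nat)" "\<psi> holomorphic_on UNIV" "inj \<psi>" "\<psi> 0 = 0" "deriv \<psi> 0 \<noteq> 0"
      "\<And>w. F (\<psi> w) = w ^ m"
  | (disc) m R \<psi> \<xi> where "0 < (m::nat)" "R > 0" "\<psi> holomorphic_on ball 0 R" "inj_on \<psi> (ball 0 R)" 
      "\<And>w. w \<in> ball 0 R \<Longrightarrow> F (\<psi> w) = w ^ m" "norm \<xi> = R"
      "filterlim (\<lambda>s. norm (\<psi> (of_real s * \<xi>))) at_top (at_left 1)"
proof -
  obtain m \<delta> \<psi>0 where m: "0 < (m::nat)" and \<delta>: "\<delta> > 0" and \<psi>0: "\<psi>0 holomorphic_on ball 0 \<delta>"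
      "\<psi>0 0 = 0" "deriv \<psi>0 0 \<noteq> 0" "\<And>w. w \<in> ball 0 \<delta> \<Longrightarrow> F (\<psi>0 w) = w ^ m"
    using power_inverse_at_zero[OF F F0 nc] by metis
  define a where "a = fps_expansion \<psi>0 0"
  define \<rho> where "\<rho> = fps_conv_radius a"
  define \<psi> where "\<psi> = eval_fps a"
  have e\<delta>: "eball 0 (ereal \<delta>) = ball (0::complex) \<delta>" by auto
  have \<rho>\<delta>: "ereal \<delta> \<le> \<rho>" unfolding \<rho>_def a_def
    by (rule conv_radius_fps_expansion) (simp add: e\<delta> \<psi>0)
  have \<psi>\<psi>0: "\<psi> w = \<psi>0 w" if "w \<in> ball 0 \<delta>" for w
    using eval_fps_expansion'[of \<psi>0 0 "ereal \<delta>" w] that by (simp add: \<psi>_def a_def e\<delta> \<psi>0)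
  have \<psi>hol: "\<psi> holomorphic_on A" if "A \<subseteq> eball 0 \<rho>" for A
    unfolding \<psi>_def using that by (auto simp: \<rho>_def intro!: holomorphic_intros)
  have \<psi>_0: "\<psi> 0 = 0" using \<psi>\<psi>0[of 0] \<delta> \<psi>0 by simp
  have d\<psi>: "deriv \<psi> 0 \<noteq> 0"
  proof -
    have "\<forall>\<^sub>F w in nhds 0. \<psi> w = \<psi>0 w"
      using eventually_nhds_in_open[of "ball 0 \<delta>" "0::complex"] \<delta> \<psi>\<psi>0 by (auto elim!: eventually_mono)
    then show ?thesis using \<psi>0(3) deriv_cong_ev by metis
  qed
  have ident: "F (\<Psi> w) = w ^ m"
    if "\<Psi> holomorphic_on ball 0 r" "\<delta> \<le> r" "\<And>w. w \<in> ball 0 \<delta> \<Longrightarrow> \<Psi> w = \<psi>0 w" "w \<in> ball 0 r" for \<Psi> r w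
  proof (rule analytic_continuation_open[of "ball 0 \<delta>" "ball 0 r" "\<lambda>w. F (\<Psi> w)" "\<lambda>w. w ^ m"])
    show "(\<lambda>w. F (\<Psi> w)) holomorphic_on ball 0 r"
      using that(1) F by (rule holomorphic_on_compose_gen[unfolded o_def]) auto
  qed (use \<delta> that \<psi>0 in \<open>auto intro!: holomorphic_intros\<close>)
  have lift: "F (\<psi> w) = w ^ m" if w: "w \<in> eball 0 \<rho>" for w
  proof (cases "norm w < \<delta>")
    case True
    then show ?thesis using \<psi>\<psi>0 \<psi>0 by simp
  next
    case False
    obtain r where r: "norm w < r" "ereal r < \<rho>"
      using ereal_dense2[of "norm w" \<rho>] w by (auto simp: in_eball_iff)
    have "ball (0::complex) r \<subseteq> eball 0 \<rho>"
      using r by (auto simp: in_eball_iff) (metis ereal_less_le less_ereal.simps(1) less_trans)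
    then show ?thesis
      by (intro ident[of \<psi> r]) (use r False \<psi>hol \<psi>\<psi>0 in auto)
  qed
  have inj_ball: "inj_on \<psi> (ball 0 r)" if "0 < r" "ball 0 r \<subseteq> eball (0::complex) \<rho>" for r
    by (rule power_inverse_inj_on[OF F F0 dF m that(1) \<psi>hol[OF that(2)] d\<psi>]) (use lift that in auto)
  show ?thesis
  proof (cases \<rho>)
    case PInf
    then have all: "A \<subseteq> eball 0 \<rho>" for A :: "complex set" by (auto simp: in_eball_iff)
    have "inj \<psi>"
    proof (rule injI)
      fix x y assume "\<psi> x = \<psi> y"
      then show "x = y"
        using inj_ball[of "norm x + norm y + 1", OF _ all] by (auto simp: inj_on_def add_nonneg_pos)
    qed
    then show ?thesis using entire[OF m \<psi>hol[OF all]] \<psi>_0 d\<psi> lift all[of UNIV] by blast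
  next
    case (real R)
    have eR: "eball 0 \<rho> = ball (0::complex) R" by (auto simp: real)
    have R: "R > 0" "\<delta> \<le> R" using \<rho>\<delta> \<delta> real by auto
    have \<psi>R: "\<psi> holomorphic_on ball 0 R" by (rule \<psi>hol) (simp add: eR)
    have "\<exists>\<xi>. norm \<xi> = R \<and> filterlim (\<lambda>s. norm (\<psi> (of_real s * \<xi>))) at_top (at_left 1)"
    proof (rule ccontr)
      assume neg: "\<not> ?thesis"
      have "\<exists>\<delta>>0. \<exists>\<kappa>. \<kappa> holomorphic_on ball \<xi> \<delta> \<and> (\<forall>w\<in>ball \<xi> \<delta> \<inter> ball 0 R. \<kappa> w = \<psi> w)"
        if "norm \<xi> = R" for \<xi>
        using neg that by (intro power_inverse_extends[OF F F0 dF m \<psi>R]) (use lift eR R in auto)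
      from holomorphic_extend_across_sphere[OF \<psi>R R(1) this]
      obtain R' \<Psi> where \<Psi>: "R' > R" "\<Psi> holomorphic_on ball 0 R'" "\<And>w. w \<in> ball 0 R \<Longrightarrow> \<Psi> w = \<psi> w"
        by blast
      have "eball 0 (ereal R') = ball (0::complex) R'" by auto
      then have "ereal R' \<le> fps_conv_radius (fps_expansion \<Psi> 0)"
        using \<Psi>(2) by (intro conv_radius_fps_expansion) simp
      also have "fps_expansion \<Psi> 0 = fps_expansion \<psi>0 0"
      proof (rule fps_expansion_cong)
        show "\<forall>\<^sub>F w in nhds 0. \<Psi> w = \<psi>0 w"
          using eventually_nhds_in_open[of "ball 0 \<delta>" "0::complex"] \<delta> \<psi>\<psi>0 \<Psi>(3) R
          by (auto elim!: eventually_mono)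
      qed
      finally show False using \<Psi>(1) real by (simp add: \<rho>_def a_def)
    qed
    then show ?thesis
      using disc[OF m R(1) \<psi>R inj_ball[OF R(1)]] lift eR by auto
  next
    case MInf
    then show ?thesis using \<rho>\<delta> by simp
  qed
qed

section \<open>Weighted length of an escaping radius\<close>

lemma power_of_log_bound:
  fixes A C :: real
  assumes "A \<ge> 0" "C \<ge> 0"
  obtains K where "K \<ge> 0" "\<And>x. 0 < x \<Longrightarrow> x \<le> 1 \<Longrightarrow> (A + C * (- ln x)) ^ n \<le> K * x powr (-1/2)"
proof -
  \<comment> \<open>Chosen so that the exponent \<open>a n\<close> is at most \<open>1/2\<close>, also for \<open>n = 0\<close>.\<close>
  define a where "a = 1 / (2 * real (n + 1))"
  have a: "a > 0" by (simp add: a_def)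
  show ?thesis
  proof (rule that[of "(A + C / a) ^ n"])
    show "0 \<le> (A + C / a) ^ n" using assms a by simp
    fix x :: real assume x: "0 < x" "x \<le> 1"
    define y where "y = 1 / x"
    have y: "y \<ge> 1" "- ln x = ln y" using x by (auto simp: y_def ln_div)
    have ya: "y powr a \<ge> 1" using y a by (simp add: ge_one_powr_ge_zero)
    have "A + C * ln y \<le> A * y powr a + C * (y powr a / a)"
      using assms ya ln_powr_bound[OF y(1) a] mult_left_mono[OF ya assms(1)] by (intro add_mono mult_left_mono) auto
    also have "\<dots> = (A + C / a) * y powr a" by (simp add: algebra_simps)
    finally have "(A + C * ln y) ^ n \<le> ((A + C / a) * y powr a) ^ n"
      using assms y by (intro power_mono) auto
    also have "\<dots> = (A + C / a) ^ n * y powr (a * real n)"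
      using y by (simp add: power_mult_distrib powr_powr[symmetric] powr_realpow)
    also have "\<dots> \<le> (A + C / a) ^ n * y powr (1/2)"
      using y assms a by (intro mult_left_mono powr_mono) (auto simp: a_def field_simps)
    also have "y powr (1/2) = x powr (-1/2)"
      using x by (simp add: y_def powr_divide powr_minus_divide)
    finally show "(A + C * (- ln x)) ^ n \<le> (A + C / a) ^ n * x powr (-1/2)" by (simp add: y)
  qed
qed

lemma nn_integral_one_minus_powr:
  "(\<integral>\<^sup>+ t\<in>{0..<1}. ennreal ((1 - t) powr (-1/2)) \<partial>lborel) \<le> 2"
proof -
  have "((\<lambda>x. x powr (-1/2)) has_integral (1 powr (-1/2 + 1) / (-1/2 + 1))) {0..1::real}"
    by (rule has_integral_powr_from_0) auto
  then have int: "((\<lambda>x. x powr (-1/2)) has_integral 2) {0..1::real}" by simp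
  have "(\<integral>\<^sup>+ t\<in>{0..<1}. ennreal ((1 - t) powr (-1/2)) \<partial>lborel)
      \<le> (\<integral>\<^sup>+ t. ennreal (indicator {0..1} (1 + (-1) * t) * (1 + (-1) * t) powr (-1/2)) \<partial>lborel)"
    by (intro nn_integral_mono) (auto simp: indicator_def)
  also have "\<dots> = (\<integral>\<^sup>+ t. ennreal (indicator {0..1} t * t powr (-1/2)) \<partial>lborel)"
    by (subst nn_integral_real_affine[of _ "-1" 1]) auto
  also have "\<dots> = ennreal 2"
    by (rule nn_integral_has_integral_lebesgue[OF _ int]) auto
  finally show ?thesis by simp
qed

lemma finite_log_weighted_integral:
  assumes L: "\<And>t. t \<in> {0..<1} \<Longrightarrow> norm (L t) \<le> A + C * (- ln (1 - t))" and "A \<ge> 0" "C \<ge> 0"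
    and D: "\<And>t. t \<in> {0..<1} \<Longrightarrow> norm (f (\<gamma> t)) * norm (vector_derivative \<gamma> (at t within {0..<1})) \<le> D"
  shows "log_weighted_integral n f \<gamma> L < \<infinity>"
proof -
  obtain K where K: "K \<ge> 0" "\<And>x. 0 < x \<Longrightarrow> x \<le> 1 \<Longrightarrow> (A + C * (- ln x)) ^ n \<le> K * x powr (-1/2)"
    using power_of_log_bound[OF assms(2,3), of n] by blast
  have D0: "D \<ge> 0" using D[of 0] by (auto intro: order_trans[rotated])
  have "log_weighted_integral n f \<gamma> L
      \<le> (\<integral>\<^sup>+ t\<in>{0..<1}. ennreal (D * K) * ennreal ((1 - t) powr (-1/2)) \<partial>lborel)"
    unfolding log_weighted_integral_def
  proof (intro nn_integral_mono)
    fix t :: real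
    show "ennreal (norm (L t) ^ n * norm (f (\<gamma> t)) * norm (vector_derivative \<gamma> (at t within {0..<1}))) * indicator {0..<1} t
        \<le> ennreal (D * K) * ennreal ((1 - t) powr (-1/2)) * indicator {0..<1} t"
    proof (cases "t \<in> {0..<1}")
      case True
      have "norm (L t) ^ n \<le> (A + C * (- ln (1 - t))) ^ n"
        using L[OF True] by (intro power_mono) auto
      also have "\<dots> \<le> K * (1 - t) powr (-1/2)" using True by (intro K) auto
      finally have "norm (L t) ^ n * (norm (f (\<gamma> t)) * norm (vector_derivative \<gamma> (at t within {0..<1})))
          \<le> K * (1 - t) powr (-1/2) * D"
        using D[OF True] K by (intro mult_mono) auto
      then show ?thesis
        using True D0 K by (simp add: ennreal_mult[symmetric] mult_ac)
    qed simp
  qed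
  also have "\<dots> = ennreal (D * K) * (\<integral>\<^sup>+ t\<in>{0..<1}. ennreal ((1 - t) powr (-1/2)) \<partial>lborel)"
    by (subst nn_integral_cmult[symmetric]) (auto simp: mult_ac)
  also have "\<dots> \<le> ennreal (D * K) * 2" by (intro mult_left_mono nn_integral_one_minus_powr) auto
  also have "\<dots> < \<infinity>" by (simp add: ennreal_mult_less_top)
  finally show ?thesis .
qed

lemma real_analytic_curve_compose_segment:
  assumes \<psi>: "\<psi> holomorphic_on U" and U: "open U"
    and line: "\<And>t. t \<in> S \<Longrightarrow> a + of_real t * b \<in> U"
  shows "real_analytic_curve_on (\<lambda>t. \<psi> (a + of_real t * b)) S"
  unfolding real_analytic_curve_on_def
proof
  fix t0 assume t0: "t0 \<in> S"
  define w0 where "w0 = a + of_real t0 * b"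
  obtain \<rho> where \<rho>: "\<rho> > 0" "ball w0 \<rho> \<subseteq> U"
    using openE[OF U line[OF t0]] by (auto simp: w0_def)
  define r where "r = \<rho> / (norm b + 1)"
  have r: "r > 0" using \<rho> by (auto simp: r_def intro!: divide_pos_pos add_nonneg_pos)
  have "(\<lambda>k. ((deriv ^^ k) \<psi> w0 / fact k * b ^ k) * of_real (t - t0) ^ k) sums \<psi> (a + of_real t * b)"
    if t: "\<bar>t - t0\<bar> < r" for t
  proof -
    have diff: "a + of_real t * b - w0 = b * of_real (t - t0)" by (simp add: w0_def algebra_simps)
    have "norm (b * of_real (t - t0)) \<le> (norm b + 1) * \<bar>t - t0\<bar>"
      unfolding norm_mult norm_of_real by (intro mult_right_mono) auto
    also have "\<dots> < (norm b + 1) * r" using t by (intro mult_strict_left_mono add_nonneg_pos) auto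
    also have "\<dots> = \<rho>" unfolding r_def by (simp add: add_nonneg_eq_0_iff)
    finally have "a + of_real t * b \<in> ball w0 \<rho>"
      unfolding diff[symmetric] mem_ball by (subst dist_commute) (simp only: dist_norm)
    from holomorphic_power_series[OF holomorphic_on_subset[OF \<psi> \<rho>(2)] this]
    show ?thesis unfolding diff by (simp add: power_mult_distrib mult_ac)
  qed
  then show "\<exists>r>0. \<exists>a'. \<forall>t\<in>S. \<bar>t - t0\<bar> < r \<longrightarrow>
        (\<lambda>k. a' k * of_real (t - t0) ^ k) sums \<psi> (a + of_real t * b)"
    using r by (intro exI[of _ r] conjI exI[of _ "\<lambda>k. (deriv ^^ k) \<psi> w0 / fact k * b ^ k"] ballI impI) auto
qed

text \<open>
  The curve is the final part of the image of the radius, reparametrised affinely so that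
  it starts where \<open>|\<psi>|\<close> is already large. All of it, together with the discs on which the
  bound for the derivative of \<open>log \<psi>\<close> is used, lies in a half disc that avoids the origin;
  this half disc is convex, so \<open>log \<psi>\<close> has a branch \<open>h\<close> there, and \<open>h\<close> also supplies the
  continuous logarithm along the curve. The bound \<open>12 \<pi> / (1 - t)\<close> for the derivative of
  that logarithm does not depend on where the curve starts.
\<close>
lemma finite_curve_of_escaping_radius:
  assumes \<psi>: "\<psi> holomorphic_on ball 0 R" and R: "R > 0" and inj: "inj_on \<psi> (ball 0 R)"
    and nz: "\<And>w. w \<in> ball 0 R \<Longrightarrow> w \<noteq> 0 \<Longrightarrow> \<psi> w \<noteq> 0"
    and \<xi>: "norm \<xi> = R" and lim: "filterlim (\<lambda>s. norm (\<psi> (of_real s * \<xi>))) at_top (at_left 1)"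
    and D: "\<And>w. w \<in> ball 0 R \<Longrightarrow> norm (\<psi> w) \<ge> r \<Longrightarrow> norm (f (\<psi> w)) * norm (deriv \<psi> w) \<le> D"
  obtains \<gamma> L where "real_analytic_curve_on \<gamma> {0..<1}" "\<gamma> ` {0..<1} \<subseteq> {\<zeta>. norm \<zeta> > 1}"
    "filterlim (\<lambda>t. norm (\<gamma> t)) at_top (at_left 1)" "log_branch_along L \<gamma>"
    "log_weighted_integral n f \<gamma> L < \<infinity>"
proof -
  have "\<forall>\<^sub>F s in at_left 1. max r 2 \<le> norm (\<psi> (of_real s * \<xi>))"
    using lim unfolding filterlim_at_top by blast
  then obtain s1 where s1: "s1 < 1" "\<And>s. s1 < s \<Longrightarrow> s < 1 \<Longrightarrow> max r 2 \<le> norm (\<psi> (of_real s * \<xi>))"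
    by (auto simp: eventually_at_left_field)
  \<comment> \<open>\<open>s0 \<ge> 1/2\<close> keeps the discs that touch the circle away from the origin.\<close>
  define s0 where "s0 = max ((s1 + 1) / 2) (1 / 2)"
  have s0: "1/2 \<le> s0" "s1 < s0" "s0 < 1" using s1(1) by (auto simp: s0_def less_max_iff_disj)
  define \<sigma> where "\<sigma> t = s0 + (1 - s0) * t" for t
  have \<sigma>1: "1 - \<sigma> t = (1 - s0) * (1 - t)" for t by (simp add: \<sigma>_def algebra_simps)
  have \<sigma>: "1/2 \<le> \<sigma> t" "s1 < \<sigma> t" "\<sigma> t < 1" if "t \<in> {0..<1}" for t
  proof -
    have "(1 - s0) * t \<ge> 0" using that s0 by simp
    then show "1/2 \<le> \<sigma> t" "s1 < \<sigma> t" using s0 by (auto simp: \<sigma>_def)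
    have "1 - \<sigma> t > 0" unfolding \<sigma>1 using that s0 by simp
    then show "\<sigma> t < 1" by simp
  qed
  define b where "b = of_real (1 - s0) * \<xi>"
  define lin where "lin t = of_real s0 * \<xi> + of_real t * b" for t
  have lin\<sigma>: "lin t = of_real (\<sigma> t) * \<xi>" for t by (simp add: lin_def \<sigma>_def b_def algebra_simps)
  define W where "W = ball 0 R \<inter> {w. \<xi> \<bullet> w > 0}"
  have W: "convex W" "open W" unfolding W_def
    by (auto intro!: convex_Int convex_halfspace_gt open_Int open_halfspace_gt)
  have subW: "ball (lin t) ((1 - \<sigma> t) * R) \<subseteq> W" if t: "t \<in> {0..<1}" for t
  proof
    fix w assume w: "w \<in> ball (lin t) ((1 - \<sigma> t) * R)"
    define v where "v = w - lin t"
    have v: "norm v < (1 - \<sigma> t) * R" using w by (simp add: v_def dist_norm norm_minus_commute)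
    have nl: "norm (lin t) = \<sigma> t * R" using \<sigma>[OF t] \<xi> by (simp add: lin\<sigma> norm_mult)
    have wv: "w = lin t + v" by (simp add: v_def)
    have "norm w \<le> \<sigma> t * R + norm v" unfolding wv nl[symmetric] by (rule norm_triangle_ineq)
    also have "\<dots> < R" using v by (simp add: algebra_simps)
    finally have "norm w < R" .
    moreover have "\<xi> \<bullet> w > 0"
    proof -
      have "\<xi> \<bullet> lin t = \<sigma> t * R^2"
        unfolding lin\<sigma> using \<xi> by (simp add: scaleR_conv_of_real[symmetric] dot_square_norm)
      moreover have "\<bar>\<xi> \<bullet> v\<bar> \<le> R * norm v" using Cauchy_Schwarz_ineq2[of \<xi> v] \<xi> by simp
      moreover have "R * norm v < R * ((1 - \<sigma> t) * R)" using v R by (intro mult_strict_left_mono)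
      moreover have "R * ((1 - \<sigma> t) * R) \<le> \<sigma> t * R^2"
        using \<sigma>(1)[OF t] R by (simp add: power2_eq_square algebra_simps)
      ultimately show ?thesis unfolding wv inner_add_right by linarith
    qed
    ultimately show "w \<in> W" by (simp add: W_def)
  qed
  have rad: "(1 - \<sigma> t) * R > 0" if "t \<in> {0..<1}" for t using \<sigma>[OF that] R by simp
  have linW: "lin t \<in> W" if "t \<in> {0..<1}" for t
    using subW[OF that] rad[OF that] by (meson centre_in_ball subsetD)
  have \<psi>W: "\<psi> holomorphic_on W" using \<psi> by (rule holomorphic_on_subset) (auto simp: W_def)
  have nzW: "\<psi> w \<noteq> 0" if "w \<in> W" for w
    using that by (intro nz) (auto simp: W_def)
  obtain h where h: "h holomorphic_on W" "\<And>w. w \<in> W \<Longrightarrow> exp (h w) = \<psi> w"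
    using holomorphic_logarithm_exists[OF W \<psi>W nzW linW[of 0]] by auto
  have dh: "(1 - \<sigma> t) * R * norm (deriv h (lin t)) \<le> 12 * pi" if t: "t \<in> {0..<1}" for t
  proof (rule log_derivative_univalent_bound[OF _ rad[OF t]])
    show "h holomorphic_on ball (lin t) ((1 - \<sigma> t) * R)" using h(1) subW[OF t] by (rule holomorphic_on_subset)
    have "inj_on \<psi> (ball (lin t) ((1 - \<sigma> t) * R))"
      using inj subW[OF t] by (auto simp: W_def intro: inj_on_subset)
    moreover have "exp (h w) = \<psi> w" if "w \<in> ball (lin t) ((1 - \<sigma> t) * R)" for w
      using h(2) subW[OF t] that by blast
    ultimately show "inj_on (\<lambda>w. exp (h w)) (ball (lin t) ((1 - \<sigma> t) * R))"
      by (simp add: inj_on_def)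
  qed
  define \<gamma> where "\<gamma> t = \<psi> (lin t)" for t
  define L where "L t = h (lin t)" for t
  have lin': "(lin has_vector_derivative b) F" for F t
    unfolding lin_def has_vector_derivative_def
    by (auto intro!: derivative_eq_intros simp: scaleR_conv_of_real)
  have \<gamma>': "(\<gamma> has_vector_derivative b * deriv \<psi> (lin t)) (at t)" if "t \<in> {0..<1}" for t
    using field_vector_diff_chain_at[OF lin' holomorphic_derivI[OF \<psi>W W(2) linW[OF that]]]
    by (simp add: \<gamma>_def[abs_def] o_def)
  have L': "(L has_vector_derivative b * deriv h (lin t)) (at t)" if "t \<in> {0..<1}" for t
    using field_vector_diff_chain_at[OF lin' holomorphic_derivI[OF h(1) W(2) linW[OF that]]]
    by (simp add: L_def[abs_def] o_def)
  have nb: "norm b = (1 - s0) * R" using s0 \<xi> by (simp add: b_def norm_mult del: of_real_diff)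
  have Lcont: "continuous_on {0..<1} L"
    using L' by (intro continuous_at_imp_continuous_on ballI has_vector_derivative_continuous)
  have \<gamma>big: "norm (\<gamma> t) \<ge> max r 2" if "t \<in> {0..<1}" for t
    unfolding \<gamma>_def lin\<sigma> using \<sigma>[OF that] by (intro s1(2))
  show ?thesis
  proof (rule that[of \<gamma> L])
    show "real_analytic_curve_on \<gamma> {0..<1}"
      unfolding \<gamma>_def[abs_def] lin_def
      by (rule real_analytic_curve_compose_segment[OF \<psi>W W(2)]) (use linW in \<open>simp add: lin_def\<close>)
    show "\<gamma> ` {0..<1} \<subseteq> {\<zeta>. norm \<zeta> > 1}" using \<gamma>big by fastforce
    have "filterlim \<sigma> (at_left 1) (at_left 1)"
      unfolding filterlim_at
    proof
      have "(\<sigma> \<longlongrightarrow> s0 + (1 - s0) * 1) (at_left 1)" unfolding \<sigma>_def by (intro tendsto_intros)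
      then show "(\<sigma> \<longlongrightarrow> 1) (at_left 1)" by simp
      have "\<forall>\<^sub>F t in at_left 1. t \<in> {0<..<1::real}" by (rule eventually_at_left_real) simp
      then show "\<forall>\<^sub>F t in at_left 1. \<sigma> t \<in> {..<1} \<and> \<sigma> t \<noteq> 1"
      proof eventually_elim
        case (elim t)
        then show ?case using \<sigma>(3)[of t] by simp
      qed
    qed
    from filterlim_compose[OF lim this]
    show "filterlim (\<lambda>t. norm (\<gamma> t)) at_top (at_left 1)" by (simp add: \<gamma>_def lin\<sigma>)
    show "log_branch_along L \<gamma>"
      unfolding log_branch_along_def L_def \<gamma>_def using Lcont h(2) linW by (simp add: L_def[abs_def])
    show "log_weighted_integral n f \<gamma> L < \<infinity>"
    proof (rule finite_log_weighted_integral)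
      fix t :: real assume t: "t \<in> {0..<1}"
      have "norm (L t - L 0) \<le> 12 * pi * (- ln (1 - t)) - 12 * pi * (- ln (1 - 0))"
      proof (cases "t = 0")
        case False
        then have "0 < t" using t by simp
        then show ?thesis
        proof (rule differentiable_bound_general)
          show "continuous_on {0..t} L" using Lcont t by (auto elim: continuous_on_subset)
          show "continuous_on {0..t} (\<lambda>t. 12 * pi * (- ln (1 - t)))"
            using t by (intro continuous_intros) auto
          fix x assume x: "0 < x" "x < t"
          then have x1: "x \<in> {0..<1}" using t by auto
          show "(L has_vector_derivative b * deriv h (lin x)) (at x)" by (rule L'[OF x1])
          show "((\<lambda>t. 12 * pi * (- ln (1 - t))) has_vector_derivative 12 * pi / (1 - x)) (at x)"
            unfolding has_real_derivative_iff_has_vector_derivative[symmetric]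
            using x1 by (auto intro!: derivative_eq_intros simp: field_simps)
          have "norm (b * deriv h (lin x)) * (1 - x) = (1 - \<sigma> x) * R * norm (deriv h (lin x))"
            by (simp add: norm_mult nb \<sigma>1)
          also have "\<dots> \<le> 12 * pi" by (rule dh[OF x1])
          finally show "norm (b * deriv h (lin x)) \<le> 12 * pi / (1 - x)"
            using x1 by (simp add: pos_le_divide_eq)
        qed
      qed simp
      moreover have "norm (L t) \<le> norm (L 0) + norm (L t - L 0)" by (rule norm_triangle_sub)
      ultimately show "norm (L t) \<le> norm (L 0) + 12 * pi * (- ln (1 - t))" by simp
      have "{0..<1} \<noteq> {a}" for a :: real
      proof
        assume "{0..<1} = {a}"
        moreover have "0 \<in> {0..<1::real}" "1/2 \<in> {0..<1::real}" by auto
        ultimately show False by simp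
      qed
      then have "t islimpt {0..<1}" by (intro connected_imp_perfect t) auto
      then have "at t within {0..<1} \<noteq> bot" by (simp add: trivial_limit_within)
      from vector_derivative_within[OF this has_vector_derivative_at_within[OF \<gamma>'[OF t]]]
      have "norm (vector_derivative \<gamma> (at t within {0..<1})) = (1 - s0) * R * norm (deriv \<psi> (lin t))"
        by (simp add: norm_mult nb)
      moreover have "norm (f (\<gamma> t)) * norm (deriv \<psi> (lin t)) \<le> D"
        unfolding \<gamma>_def using linW[OF t] \<gamma>big[OF t] by (intro D) (auto simp: W_def \<gamma>_def)
      then have "(1 - s0) * R * (norm (f (\<gamma> t)) * norm (deriv \<psi> (lin t))) \<le> (1 - s0) * R * D"
        using s0 R by (intro mult_left_mono) auto
      ultimately show "norm (f (\<gamma> t)) * norm (vector_derivative \<gamma> (at t within {0..<1})) \<le> (1 - s0) * R * D"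
        by (simp add: mult_ac)
    qed auto
  qed
qed

section \<open>Polynomial growth and the theorem\<close>

text \<open>
  After multiplication by \<open>w\<^sup>P\<^sup>+\<^sup>1\<close> the function tends to 0 at the origin in the coordinate
  \<open>w = 1/\<zeta>\<close>, so its own singularity there is not essential.
\<close>
lemma meromorphic_at_infinity_of_polynomial_growth:
  assumes f: "f holomorphic_on {\<zeta>. norm \<zeta> > 1}"
    and K: "\<And>z. norm z \<ge> r \<Longrightarrow> norm (f z) \<le> K * norm z ^ P"
  shows "meromorphic_at_infinity f"
proof -
  have hol: "(\<lambda>w. f (inverse w)) holomorphic_on ball 0 1 - {0}"
    by (rule holomorphic_on_compose_gen[OF _ f, unfolded o_def])
       (auto intro!: holomorphic_intros simp: norm_inverse one_less_inverse_iff)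
  have iso: "isolated_singularity_at (\<lambda>w. f (inverse w)) 0"
    by (rule isolated_singularity_at_holomorphic[OF hol]) auto
  define s where "s = inverse (max r 1)"
  have s: "s > 0" by (simp add: s_def)
  have "((\<lambda>w. w ^ Suc P * f (inverse w)) \<longlongrightarrow> 0) (at 0)"
  proof (rule Lim_null_comparison[where g = "\<lambda>w. K * norm w"])
    have "\<forall>\<^sub>F w in at 0. w \<in> ball (0::complex) s - {0}"
      using s by (intro eventually_at_in_open) auto
    then show "\<forall>\<^sub>F w in at 0. norm (w ^ Suc P * f (inverse w)) \<le> K * norm w"
    proof eventually_elim
      case (elim w)
      then have w: "norm w > 0" "norm w < s" by auto
      then have "inverse (norm w) \<ge> max r 1"
        using le_imp_inverse_le[of "norm w" s] by (simp add: s_def)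
      then have "norm (f (inverse w)) \<le> K * norm (inverse w) ^ P"
        by (intro K) (simp add: norm_inverse)
      then have "norm (w ^ Suc P * f (inverse w)) \<le> norm w ^ Suc P * (K * norm (inverse w) ^ P)"
        unfolding norm_mult norm_power by (intro mult_left_mono) auto
      also have "\<dots> = K * norm w * (norm w * norm (inverse w)) ^ P"
        by (simp add: power_mult_distrib mult_ac)
      also have "norm w * norm (inverse w) = 1" using w by (simp add: norm_inverse)
      finally show ?case by simp
    qed
    have "((\<lambda>w::complex. K * norm w) \<longlongrightarrow> K * norm (0::complex)) (at 0)" by (intro tendsto_intros)
    then show "((\<lambda>w::complex. K * norm w) \<longlongrightarrow> 0) (at 0)" by simp
  qed
  then have ne: "not_essential (\<lambda>w. w ^ Suc P * f (inverse w)) 0" by blast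
  have mono: "isolated_singularity_at (\<lambda>w. w ^ Suc P) (0::complex)" "not_essential (\<lambda>w. w ^ Suc P) (0::complex)"
    by (auto intro!: isolated_singularity_at_analytic not_essential_analytic analytic_intros simp del: power_Suc)
  have "not_essential (\<lambda>w. (w ^ Suc P * f (inverse w)) / w ^ Suc P) 0"
    by (intro not_essential_divide ne mono isolated_singularity_at_times iso)
  moreover have "\<forall>\<^sub>F w in at 0. (w ^ Suc P * f (inverse w)) / w ^ Suc P = f (inverse w)"
    by (auto simp: eventually_at_filter)
  ultimately have "not_essential (\<lambda>w. f (inverse w)) 0" by (rule not_essential_transform)
  then show ?thesis using iso by (simp add: meromorphic_at_infinity_def)
qed

theorem mainTheorem1:
  fixes f :: "complex \<Rightarrow> complex" and n :: nat
  assumes "f holomorphic_on {\<zeta>. norm \<zeta> > 1}"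
    and "f ` {\<zeta>. norm \<zeta> > 1} \<subseteq> UNIV - {0}"
    and "\<And>\<gamma> L :: real \<Rightarrow> complex.
           real_analytic_curve_on \<gamma> {0..<1} \<Longrightarrow>
           \<gamma> ` {0..<1} \<subseteq> {\<zeta>. norm \<zeta> > 1} \<Longrightarrow>
           filterlim (\<lambda>t. norm (\<gamma> t)) at_top (at_left 1) \<Longrightarrow>
           log_branch_along L \<gamma> \<Longrightarrow>
           log_weighted_integral n f \<gamma> L = \<infinity>"
  shows "meromorphic_at_infinity f"
proof -
  have nz: "f z \<noteq> 0" if "norm z > 1" for z using assms(2) that by blast
  obtain G K and M :: nat where G: "G holomorphic_on UNIV" and "K > 0"
    and fG: "\<And>z. norm z \<ge> 2 \<Longrightarrow> norm (f z) \<le> K * norm (z ^ M * exp (G z))"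
    using exterior_factorization[OF assms(1) nz] by blast
  have "(\<lambda>z. z ^ M * exp (G z)) holomorphic_on UNIV" by (intro holomorphic_intros G)
  then obtain F0 where F0: "\<And>z. (F0 has_field_derivative z ^ M * exp (G z)) (at z)"
    using holomorphic_convex_primitive'[OF convex_UNIV open_UNIV] by auto
  define F where "F z = F0 z - F0 0" for z
  have F': "(F has_field_derivative z ^ M * exp (G z)) (at z)" for z
    unfolding F_def[abs_def] by (auto intro!: derivative_eq_intros F0)
  have F: "F holomorphic_on UNIV" using F' by (auto simp: holomorphic_on_open)
  have dF: "deriv F z = z ^ M * exp (G z)" for z by (rule DERIV_imp_deriv[OF F'])
  have F_0: "F 0 = 0" by (simp add: F_def)
  have nc: "\<not> F constant_on UNIV"
  proof
    assume "F constant_on UNIV"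
    then have "F = (\<lambda>_. F 0)" by (auto simp: constant_on_def)
    then have "deriv F 1 = 0" by (metis deriv_const)
    then show False by (simp add: dF)
  qed
  have dFnz: "deriv F z \<noteq> 0" if "z \<noteq> 0" for z using that by (simp add: dF)
  show ?thesis
  proof (rule power_inverse_maximal_disc[OF F F_0 dFnz nc])
    fix m :: nat and \<psi>
    assume m: "0 < m" and \<psi>: "\<psi> holomorphic_on UNIV" "inj \<psi>" "\<psi> 0 = 0" "deriv \<psi> 0 \<noteq> 0"
      and eq: "\<And>w. F (\<psi> w) = w ^ m"
    obtain c where c: "c \<noteq> 0" "\<And>w. \<psi> w = c * w" using entire_injective_imp_linear[OF \<psi>] by blast
    have "norm (f z) \<le> (K * m / norm c ^ m) * norm z ^ (m - 1)" if z: "norm z \<ge> 2" for z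
    proof -
      have "F x = (x / c) ^ m" for x using eq[of "x / c"] c by simp
      then have "F = (\<lambda>x. (x / c) ^ m)" by (rule ext)
      then have "(F has_field_derivative of_nat m * (z / c) ^ (m - 1) * (1 / c)) (at z)"
        using c by (auto intro!: derivative_eq_intros)
      then have "z ^ M * exp (G z) = of_nat m * (z / c) ^ (m - 1) * (1 / c)"
        using F' by (rule DERIV_unique[rotated])
      also have "\<dots> = of_nat m * z ^ (m - 1) / c ^ m"
        using m c by (cases m) (auto simp: power_divide field_simps)
      finally have "norm (z ^ M * exp (G z)) = m * norm z ^ (m - 1) / norm c ^ m"
        by (simp only: norm_divide norm_mult norm_power norm_of_nat)
      then show ?thesis using fG[OF z] by simp
    qed
    then show ?thesis by (rule meromorphic_at_infinity_of_polynomial_growth[OF assms(1)])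
  next
    fix m :: nat and R :: real and \<psi> \<xi>
    assume m: "0 < m" and R: "R > 0" and \<psi>: "\<psi> holomorphic_on ball 0 R" "inj_on \<psi> (ball 0 R)"
      and eq: "\<And>w. w \<in> ball 0 R \<Longrightarrow> F (\<psi> w) = w ^ m" and \<xi>: "norm \<xi> = R"
      and lim: "filterlim (\<lambda>s. norm (\<psi> (of_real s * \<xi>))) at_top (at_left 1)"
    have D: "norm (f (\<psi> w)) * norm (deriv \<psi> w) \<le> K * (m * R ^ (m - 1))"
      if w: "w \<in> ball 0 R" and big: "norm (\<psi> w) \<ge> 2" for w
    proof -
      have "(\<psi> has_field_derivative deriv \<psi> w) (at w)" using holomorphic_derivI[OF \<psi>(1) open_ball w] .
      from DERIV_chain2[OF F' this]
      have "((\<lambda>w. w ^ m) has_field_derivative (\<psi> w ^ M * exp (G (\<psi> w))) * deriv \<psi> w) (at w)"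
        by (rule has_field_derivative_transform_within_open[OF _ open_ball w]) (rule eq)
      moreover have "((\<lambda>w. w ^ m) has_field_derivative of_nat m * w ^ (m - 1)) (at w)"
        by (auto intro!: derivative_eq_intros)
      ultimately have *: "(\<psi> w ^ M * exp (G (\<psi> w))) * deriv \<psi> w = of_nat m * w ^ (m - 1)"
        by (rule DERIV_unique)
      have "norm (f (\<psi> w)) * norm (deriv \<psi> w) \<le> K * norm (\<psi> w ^ M * exp (G (\<psi> w))) * norm (deriv \<psi> w)"
        by (intro mult_right_mono fG big) auto
      also have "\<dots> = K * norm ((\<psi> w ^ M * exp (G (\<psi> w))) * deriv \<psi> w)"
        by (simp only: norm_mult mult.assoc)
      also have "\<dots> = K * (m * norm w ^ (m - 1))"
        unfolding * by (simp only: norm_mult norm_power norm_of_nat)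
      also have "\<dots> \<le> K * (m * R ^ (m - 1))"
        using w \<open>K > 0\<close> by (intro mult_left_mono power_mono) auto
      finally show ?thesis .
    qed
    have "\<psi> w \<noteq> 0" if "w \<in> ball 0 R" "w \<noteq> 0" for w
      using power_inverse_nonzero[OF F_0 eq] that by blast
    from finite_curve_of_escaping_radius[OF \<psi>(1) R \<psi>(2) this \<xi> lim D]
    obtain \<gamma> L where "real_analytic_curve_on \<gamma> {0..<1}" "\<gamma> ` {0..<1} \<subseteq> {\<zeta>. norm \<zeta> > 1}"
      "filterlim (\<lambda>t. norm (\<gamma> t)) at_top (at_left 1)" "log_branch_along L \<gamma>"
      "log_weighted_integral n f \<gamma> L < \<infinity>" by blast
    then show ?thesis using assms(3)[of \<gamma> L] by simp
  qed
qed

end
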